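(* Let $I=\langle h_1,\ldots,h_m\rangle\subseteq\mathbb{R}[x]$, let $h_{m+1},\ldots,h_{m+k}\in\mathbb{R}[x]$ and $S=\{x\in\mathbb{R}^n : h_{m+1}(x)\ge 0,\ldots,h_{m+k}(x)\ge 0\}$. Let $t\ge d$ and let $y\in K_{t,S}^{\mathbb{R}}$ be such that $\operatorname{rank} M_t^{\mathbb{R}}(y)$ is maximum over $K_{t,S}^{\mathbb{R}}$. (i) Assume $\operatorname{rank} M_s^{\mathbb{R}}(y)=\operatorname{rank} M_{s-1}^{\mathbb{R}}(y)$ for some $1\le s\le t$. Then $J:=\langle\operatorname{Ker} M_s^{\mathbb{R}}(y)\rangle\subseteq I(V_{\mathbb{R}}(I)\cap S)$ and $W:=V_{\mathbb{C}}(J)\supseteq V_{\mathbb{R}}(I)\cap S$ with $|W|=\operatorname{rank} M_s^{\mathbb{R}}(y)$; moreover, $J=I(V_{\mathbb{R}}(I)\cap S)$ if $W=V_{\mathbb{R}}(I)\cap S$. (ii) Assume $\operatorname{rank} M_s^{\mathbb{R}}(y)=\operatorname{rank} M_{s-d}^{\mathbb{R}}(y)$ for some $d\le s\le t$. Then $I(V_{\mathbb{R}}(I)\cap S)=\langle\operatorname{Ker} M_s^{\mathbb{R}}(y)\rangle$.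
   Context: $\mathbb{R}[x]=\mathbb{R}[x_1,\ldots,x_n]$; $V_{\mathbb{C}}(J)$ and $V_{\mathbb{R}}(J)=V_{\mathbb{C}}(J)\cap\mathbb{R}^n$ are the complex and real zero sets of an ideal $J$; $I(V)$ is the ideal of polynomials in $\mathbb{R}[x]$ vanishing on $V$; $\langle A\rangle$ is the ideal generated by $A$. For $\alpha\in\mathbb{N}^n$, $|\alpha|=\sum_i\alpha_i$; $\mathbb{N}^n_t=\{\alpha:|\alpha|\le t\}$. Set $d_j:=\lceil\deg(h_j)/2\rceil$ for $j=1,\ldots,m+k$ and $d:=\max_{j=1,\ldots,m+k}d_j$. For $y\in\mathbb{R}^{\mathbb{N}^n_{2t}}$ and $0\le s\le t$, $M_s^{\mathbb{R}}(y)$ is the matrix indexed by $\mathbb{N}^n_s$ with $(\alpha,\beta)$ entry $y_{\alpha+\beta}$; its kernel is viewed as a set of polynomials of degree at most $s$ (a polynomial being identified with its coefficient vector). For $h=\sum_\beta h_\beta x^\beta$, $(hy)_\alpha=\sum_\beta h_\beta y_{\alpha+\beta}$. For $t\ge d$, $$K_{t,S}^{\mathbb{R}}:=\{y\in\mathbb{R}^{\mathbb{N}^n_{2t}} : y_0=1,\ M_t^{\mathbb{R}}(y)\succeq 0,\ M_{t-d_j}^{\mathbb{R}}(h_jy)=0\ (1\le j\le m),\ M_{t-d_j}^{\mathbb{R}}(h_jy)\succeq 0\ (m+1\le j\le m+k)\}.$$ *)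

theory Defs
  imports "HOL-Analysis.Analysis" "HOL-Analysis.Finite_Function_Topology"
begin

type_synonym 'n monom = "'n \<Rightarrow>\<^sub>0 nat"
type_synonym ('n, 'a) mpoly = "'n monom \<Rightarrow>\<^sub>0 'a"

text \<open>Polynomials in the variables indexed by the finite type \<^typ>\<open>'n\<close> are finitely supported
  maps from exponents to coefficients; the ring structure is the one of
  \<^theory>\<open>HOL-Library.Poly_Mapping\<close>, the real vector space structure the one of
  \<^theory>\<open>HOL-Analysis.Finite_Function_Topology\<close>.\<close>

definition mdeg :: "'n::finite monom \<Rightarrow> nat"
  where "mdeg \<alpha> = (\<Sum>i\<in>UNIV. Poly_Mapping.lookup \<alpha> i)"

definition monoms :: "nat \<Rightarrow> 'n::finite monom set"
  where "monoms t = {\<alpha>. mdeg \<alpha> \<le> t}"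

lemma finite_monoms [simp]: "finite (monoms t :: 'n::finite monom set)"
proof -
  have "Poly_Mapping.lookup \<alpha> i \<le> t" if "\<alpha> \<in> monoms t" for \<alpha> :: "'n monom" and i
    using that member_le_sum[of i UNIV "Poly_Mapping.lookup \<alpha>"]
    by (simp add: monoms_def mdeg_def)
  then have "Poly_Mapping.lookup ` (monoms t :: 'n monom set) \<subseteq> PiE UNIV (\<lambda>_. {..t})"
    by auto
  moreover have "finite (PiE (UNIV :: 'n set) (\<lambda>_. {..t}))"
    by (intro finite_PiE) auto
  ultimately have "finite (Poly_Mapping.lookup ` (monoms t :: 'n monom set))"
    by (rule finite_subset)
  then show ?thesis
    by (rule finite_imageD) (auto intro!: inj_onI poly_mapping_eqI)
qed

text \<open>Total degree, with the convention that the zero polynomial has degree 0.\<close>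

definition tdeg :: "('n::finite, 'a::zero) mpoly \<Rightarrow> nat"
  where "tdeg p = Max (insert 0 (mdeg ` Poly_Mapping.keys p))"

definition eval_mpoly :: "('n::finite, real) mpoly \<Rightarrow> 'a::{real_algebra_1,comm_ring_1} ^ 'n \<Rightarrow> 'a"
  where "eval_mpoly p x =
    (\<Sum>\<alpha>\<in>Poly_Mapping.keys p.
       of_real (Poly_Mapping.lookup p \<alpha>) * (\<Prod>i\<in>UNIV. (x $ i) ^ Poly_Mapping.lookup \<alpha> i))"

text \<open>An ideal of a commutative ring is a submodule of the ring regarded as a module over itself.\<close>

definition gen_ideal :: "'a::comm_ring_1 set \<Rightarrow> 'a set"
  where "gen_ideal A = module.span (*) A"

lemma module_times: "module ((*) :: 'a::comm_ring_1 \<Rightarrow> 'a \<Rightarrow> 'a)"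
  by unfold_locales (simp_all add: algebra_simps)

definition complex_variety :: "('n::finite, real) mpoly set \<Rightarrow> (complex ^ 'n) set"
  where "complex_variety J = {z. \<forall>p\<in>J. eval_mpoly p z = 0}"

definition complex_point :: "real ^ 'n::finite \<Rightarrow> complex ^ 'n"
  where "complex_point x = (\<chi> i. complex_of_real (x $ i))"

definition real_variety :: "('n::finite, real) mpoly set \<Rightarrow> (real ^ 'n) set"
  where "real_variety J = {x. complex_point x \<in> complex_variety J}"

definition vanishing_ideal :: "(real ^ 'n) set \<Rightarrow> ('n::finite, real) mpoly set"
  where "vanishing_ideal V = {p. \<forall>x\<in>V. eval_mpoly p x = 0}"

text \<open>A real matrix with rows and columns indexed by a finite set \<open>A\<close> is a function
  \<open>M\<close> of two arguments of which only the values on \<open>A \<times> A\<close> matter; vectors in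
  \<open>\<real>\<^sup>A\<close> are the finitely supported functions with support in \<open>A\<close>, so that a vector indexed by
  exponents is literally a polynomial.\<close>

definition mat_column :: "'i set \<Rightarrow> ('i \<Rightarrow> 'i \<Rightarrow> real) \<Rightarrow> 'i \<Rightarrow> ('i \<Rightarrow>\<^sub>0 real)"
  where "mat_column A M j = (\<Sum>i\<in>A. Poly_Mapping.single i (M i j))"

lemma lookup_mat_column:
  "finite A \<Longrightarrow> Poly_Mapping.lookup (mat_column A M j) i = (if i \<in> A then M i j else 0)"
  by (simp add: mat_column_def lookup_sum lookup_single when_def)

definition mat_rank :: "'i set \<Rightarrow> ('i \<Rightarrow> 'i \<Rightarrow> real) \<Rightarrow> nat"
  where "mat_rank A M = dim (mat_column A M ` A)"

definition mat_kernel :: "'i set \<Rightarrow> ('i \<Rightarrow> 'i \<Rightarrow> real) \<Rightarrow> ('i \<Rightarrow>\<^sub>0 real) set"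
  where "mat_kernel A M =
    {p. Poly_Mapping.keys p \<subseteq> A \<and> (\<forall>i\<in>A. (\<Sum>j\<in>A. M i j * Poly_Mapping.lookup p j) = 0)}"

definition mat_psd :: "'i set \<Rightarrow> ('i \<Rightarrow> 'i \<Rightarrow> real) \<Rightarrow> bool"
  where "mat_psd A M \<longleftrightarrow>
    (\<forall>i\<in>A. \<forall>j\<in>A. M i j = M j i) \<and>
    (\<forall>v. 0 \<le> (\<Sum>i\<in>A. \<Sum>j\<in>A. v i * M i j * v j))"

definition mat_zero :: "'i set \<Rightarrow> ('i \<Rightarrow> 'i \<Rightarrow> real) \<Rightarrow> bool"
  where "mat_zero A M \<longleftrightarrow> (\<forall>i\<in>A. \<forall>j\<in>A. M i j = 0)"

text \<open>The truncated moment matrix of order \<open>s\<close> is \<open>moment_mat y\<close> on the index set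
  \<open>monoms s\<close>.\<close>

definition moment_mat :: "('n monom \<Rightarrow> real) \<Rightarrow> 'n monom \<Rightarrow> 'n monom \<Rightarrow> real"
  where "moment_mat y \<alpha> \<beta> = y (\<alpha> + \<beta>)"

definition moment_rank :: "nat \<Rightarrow> ('n::finite monom \<Rightarrow> real) \<Rightarrow> nat"
  where "moment_rank s y = mat_rank (monoms s) (moment_mat y)"

definition moment_kernel :: "nat \<Rightarrow> ('n::finite monom \<Rightarrow> real) \<Rightarrow> ('n, real) mpoly set"
  where "moment_kernel s y = mat_kernel (monoms s) (moment_mat y)"

definition shift_seq :: "('n, real) mpoly \<Rightarrow> ('n monom \<Rightarrow> real) \<Rightarrow> 'n monom \<Rightarrow> real"
  where "shift_seq h y \<alpha> =
    (\<Sum>\<beta>\<in>Poly_Mapping.keys h. Poly_Mapping.lookup h \<beta> * y (\<alpha> + \<beta>))"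

definition half_deg :: "('n::finite, real) mpoly \<Rightarrow> nat"
  where "half_deg p = nat \<lceil>real (tdeg p) / 2\<rceil>"

text \<open>The maximum of the \<open>d\<^sub>j\<close>; it is 0 if there are no polynomials at all (\<open>m + k = 0\<close>).\<close>

definition max_half_deg :: "(nat \<Rightarrow> ('n::finite, real) mpoly) \<Rightarrow> nat \<Rightarrow> nat"
  where "max_half_deg h l = Max (insert 0 ((\<lambda>j. half_deg (h j)) ` {1..l}))"

definition basic_closed_set ::
    "(nat \<Rightarrow> ('n::finite, real) mpoly) \<Rightarrow> nat \<Rightarrow> nat \<Rightarrow> (real ^ 'n) set"
  where "basic_closed_set h m k = {x. \<forall>j\<in>{m+1..m+k}. 0 \<le> eval_mpoly (h j) x}"

text \<open>Elements of \<open>\<real>\<close> to the power \<open>monoms (2 * t)\<close> are represented by functions that are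
  \<^const>\<open>undefined\<close> outside \<^term>\<open>monoms (2 * t)\<close>; for \<open>t\<close> at least the maximum of the
  \<open>d\<^sub>j\<close> no value outside this set is used in the conditions below.\<close>

definition K_set ::
    "(nat \<Rightarrow> ('n::finite, real) mpoly) \<Rightarrow> nat \<Rightarrow> nat \<Rightarrow> nat \<Rightarrow> ('n monom \<Rightarrow> real) set"
  where "K_set h m k t =
    {y \<in> monoms (2 * t) \<rightarrow>\<^sub>E UNIV.
       y 0 = 1 \<and>
       mat_psd (monoms t) (moment_mat y) \<and>
       (\<forall>j\<in>{1..m}.
          mat_zero (monoms (t - half_deg (h j))) (moment_mat (shift_seq (h j) y))) \<and>
       (\<forall>j\<in>{m+1..m+k}.
          mat_psd (monoms (t - half_deg (h j))) (moment_mat (shift_seq (h j) y)))}"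

end

theory Submission
  imports Defs "HOL-Computational_Algebra.Fundamental_Theorem_Algebra"
begin

text \<open>
  Write \<open>L\<close> for the functional \<open>p \<mapsto> \<Sum>\<alpha>. p\<^sub>\<alpha> y\<^sub>\<alpha>\<close>, \<open>N\<close> for the kernel of the moment matrix of order
  \<open>s\<close>, \<open>J\<close> for the ideal generated by \<open>N\<close>, and \<open>V\<close> for the real zeros of \<open>I\<close> in \<open>S\<close>. Moment matrices
  are the Gram matrices of the form \<open>L (p * q)\<close>, so membership in \<open>K_set\<close> is a statement about \<open>L\<close>
  (\<open>K_set_iff\<close>), and by positivity the kernel of order \<open>s \<le> t\<close> is the part of degree at most \<open>s\<close> of the
  kernel of order \<open>t\<close>.

  Maximality of the rank gives the inclusion of \<open>J\<close> in the vanishing ideal of \<open>V\<close>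
  (\<open>max_rank_kernel_vanishes\<close>): the average of \<open>y\<close> and the moment sequence of a point \<open>x\<close> of \<open>V\<close> is again
  feasible, its kernel is the intersection of the two kernels, and since its rank is not larger than
  that of \<open>y\<close> the kernel of \<open>y\<close> consists of polynomials vanishing at \<open>x\<close>.

  Flatness determines \<open>J\<close> completely (\<open>flat_extension\<close>). Every polynomial of degree at most \<open>s\<close> is
  congruent modulo \<open>N\<close> to one of degree at most \<open>s - 1\<close>, so multiplication by a variable induces an
  operator on the quotient by \<open>N\<close>, a finite-dimensional inner product space. These operators are
  symmetric and commute, because both \<open>\<langle>X\<^sub>i p, q\<rangle>\<close> and \<open>\<langle>X\<^sub>i X\<^sub>j p, q\<rangle>\<close> are values of \<open>L\<close> at products. The
  polynomial ring therefore acts on the quotient; the polynomials annihilating the class of \<open>1\<close> are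
  exactly \<open>J\<close>, and \<open>\<Lambda> p = \<langle>p(X) 1, 1\<rangle>\<close> extends \<open>L\<close> to a functional on all polynomials that vanishes on
  \<open>J\<close> and satisfies \<open>\<Lambda> (p * p) > 0\<close> off \<open>J\<close>.

  By positivity of \<open>\<Lambda>\<close>, if \<open>p\<^sup>2 + r\<^sup>2\<close> is in \<open>J\<close> then so are \<open>p\<close> and \<open>r\<close>; moreover \<open>J\<close> has finite
  codimension. Such an ideal is the vanishing ideal of a finite set \<open>W\<close> of real points and has
  no other complex zeros (\<open>real_radical_finite_codim\<close>): any \<open>p\<close> outside \<open>J\<close> has a multiple outside \<open>J\<close>
  that is a joint eigenvector modulo \<open>J\<close> of the multiplications by the variables, and the eigenvalues
  are the coordinates of a real zero of \<open>J\<close> at which \<open>p\<close> does not vanish. Interpolation polynomials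
  for \<open>W\<close> form a basis modulo \<open>N\<close>, hence \<open>W\<close> has as many points as the rank. This is part (i).

  For part (ii) with \<open>d \<ge> 1\<close>, the interpolation polynomial \<open>e\<close> at a point \<open>w\<close> of \<open>W\<close> can be chosen of
  degree at most \<open>s - d\<close>. Then \<open>h\<^sub>j e\<^sup>2\<close> has degree at most \<open>2 s\<close>, so
  \<open>L (h\<^sub>j e\<^sup>2) = \<Lambda> (h\<^sub>j e\<^sup>2) = h\<^sub>j(w) \<Lambda> (e\<^sup>2)\<close> with \<open>\<Lambda> (e\<^sup>2) > 0\<close>: the localizing constraints on \<open>y\<close> put
  \<open>w\<close> into \<open>V\<close>, and \<open>W \<subseteq> V\<close> gives the missing inclusion. For \<open>d = 0\<close> the rank condition is void, but
  the constraints are constants, \<open>V\<close> is the whole space, and its vanishing ideal is zero.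
\<close>

section \<open>Linear functionals on polynomials\<close>

text \<open>The functional of a moment sequence, the evaluation at a point, the map given by the columns of
  a matrix and the orbit map \<open>p \<mapsto> p(X) 1\<close> of commuting operators are all linear extensions of a map on
  exponents; what is needed of them follows from linearity and \<open>lin_ext_mult\<close>.\<close>

definition lin_ext :: "('a \<Rightarrow> 'b::real_vector) \<Rightarrow> ('a \<Rightarrow>\<^sub>0 real) \<Rightarrow> 'b"
  where "lin_ext f p = (\<Sum>a\<in>Poly_Mapping.keys p. Poly_Mapping.lookup p a *\<^sub>R f a)"

lemma lookup_scaleR [simp]:
  "Poly_Mapping.lookup (c *\<^sub>R p) a = c *\<^sub>R Poly_Mapping.lookup p a"
  by (simp add: scaleR_poly_mapping_def)

lemma keys_scaleR_subset: "Poly_Mapping.keys (c *\<^sub>R p) \<subseteq> Poly_Mapping.keys p"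
  by (auto simp: in_keys_iff)

lemma lin_ext_superset:
  assumes "finite A" "Poly_Mapping.keys p \<subseteq> A"
  shows "lin_ext f p = (\<Sum>a\<in>A. Poly_Mapping.lookup p a *\<^sub>R f a)"
  unfolding lin_ext_def using assms
  by (intro sum.mono_neutral_left) (auto simp: in_keys_iff)

lemma linear_lin_ext: "linear (lin_ext f)"
proof (rule linearI)
  fix p q :: "'a \<Rightarrow>\<^sub>0 real"
  let ?A = "Poly_Mapping.keys p \<union> Poly_Mapping.keys q"
  have "lin_ext f (p + q) = (\<Sum>a\<in>?A. Poly_Mapping.lookup (p + q) a *\<^sub>R f a)"
    by (rule lin_ext_superset) (auto simp: keys_add)
  also have "\<dots> = (\<Sum>a\<in>?A. Poly_Mapping.lookup p a *\<^sub>R f a) + (\<Sum>a\<in>?A. Poly_Mapping.lookup q a *\<^sub>R f a)"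
    by (simp add: lookup_add scaleR_add_left sum.distrib)
  also have "\<dots> = lin_ext f p + lin_ext f q"
    by (simp add: lin_ext_superset[of ?A])
  finally show "lin_ext f (p + q) = lin_ext f p + lin_ext f q" .
next
  fix c and p :: "'a \<Rightarrow>\<^sub>0 real"
  show "lin_ext f (c *\<^sub>R p) = c *\<^sub>R lin_ext f p"
    using lin_ext_superset[OF finite_keys keys_scaleR_subset, of f c p]
    by (simp add: lin_ext_def scaleR_right.sum)
qed

lemmas lin_ext_simps [simp] =
  linear_add[OF linear_lin_ext] linear_diff[OF linear_lin_ext] linear_scale[OF linear_lin_ext]
  linear_0[OF linear_lin_ext] linear_sum[OF linear_lin_ext] linear_neg[OF linear_lin_ext]

lemma lin_ext_single [simp]: "lin_ext f (Poly_Mapping.single a c) = c *\<^sub>R f a"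
  by (simp add: lin_ext_def)

lemma scaleR_single [simp]:
  "c *\<^sub>R Poly_Mapping.single a b = Poly_Mapping.single a (c * b :: real)"
  by (rule poly_mapping_eqI) (simp add: lookup_single when_def)

lemma lin_ext_single_id: "lin_ext (\<lambda>a. Poly_Mapping.single a 1) p = p"
  by (rule poly_mapping_eqI)
    (simp add: lin_ext_def lookup_sum lookup_single when_def in_keys_iff)

lemma linear_eq_lin_ext:
  assumes "linear g"
  shows "g p = lin_ext (\<lambda>a. g (Poly_Mapping.single a 1)) p"
proof -
  have "g p = g (lin_ext (\<lambda>a. Poly_Mapping.single a 1) p)"
    by (simp only: lin_ext_single_id)
  also have "\<dots> = lin_ext (\<lambda>a. g (Poly_Mapping.single a 1)) p"
    by (simp only: lin_ext_def linear_sum[OF assms] linear_scale[OF assms])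
  finally show ?thesis .
qed

text \<open>The form in which linear identities are reduced to monomials: the solutions of the identity are
  the subspace \<open>V\<close>.\<close>

lemma mpoly_subspace_induct:
  fixes p :: "'a \<Rightarrow>\<^sub>0 real"
  assumes "subspace V" "\<And>a. a \<in> Poly_Mapping.keys p \<Longrightarrow> Poly_Mapping.single a 1 \<in> V"
  shows "p \<in> V"
proof -
  have "lin_ext (\<lambda>a. Poly_Mapping.single a 1) p \<in> V"
    unfolding lin_ext_def using assms by (intro subspace_sum subspace_scale) auto
  then show ?thesis by (simp only: lin_ext_single_id)
qed

lemma mpoly_scaleR_mult_left [simp]: 
  fixes p q :: "('n, real) mpoly"
  shows "(c *\<^sub>R p) * q = c *\<^sub>R (p * q)"
proof -
  have *: "c *\<^sub>R p = Poly_Mapping.single 0 c * p" for p :: "('n, real) mpoly"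
    by (rule poly_mapping_eqI) (simp add: map.rep_eq when_def flip: mult_map_scale_conv_mult)
  show ?thesis by (simp add: * mult.assoc)
qed

lemma mpoly_scaleR_mult_right [simp]: 
  fixes p q :: "('n, real) mpoly"
  shows "p * (c *\<^sub>R q) = c *\<^sub>R (p * q)"
  by (metis mult.commute mpoly_scaleR_mult_left)

lemma linear_mult_left: "linear (\<lambda>p :: ('n, real) mpoly. p * q)"
  by (rule linearI) (simp_all add: distrib_right)

lemma linear_mult_right: "linear (\<lambda>p :: ('n, real) mpoly. q * p)"
  by (rule linearI) (simp_all add: distrib_left)

lemma lin_ext_mult:
  fixes p q :: "('n, real) mpoly"
  shows "lin_ext f (p * q) = lin_ext (\<lambda>\<alpha>. lin_ext (\<lambda>\<beta>. f (\<alpha> + \<beta>)) q) p"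
proof -
  have "lin_ext f (p * q) = lin_ext (\<lambda>\<alpha>. lin_ext f (Poly_Mapping.single \<alpha> 1 * q)) p"
    using linear_eq_lin_ext[OF linear_compose[OF linear_mult_left linear_lin_ext, of f q], of p] by simp
  moreover have "lin_ext f (Poly_Mapping.single \<alpha> 1 * q) = lin_ext (\<lambda>\<beta>. f (\<alpha> + \<beta>)) q" for \<alpha>
    using linear_eq_lin_ext[OF linear_compose[OF linear_mult_right linear_lin_ext, 
        of f "Poly_Mapping.single \<alpha> 1"], of q]
    by (simp add: mult_single)
  ultimately show ?thesis by simp
qed

section \<open>Evaluation\<close>

lemma eval_eq_lin_ext:
  "eval_mpoly p x = lin_ext (\<lambda>\<alpha>. \<Prod>i\<in>UNIV. (x $ i) ^ Poly_Mapping.lookup \<alpha> i) p"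
  by (simp add: eval_mpoly_def lin_ext_def scaleR_conv_of_real)

lemma eval_add [simp]: "eval_mpoly (p + q) x = eval_mpoly p x + eval_mpoly q x"
  and eval_diff [simp]: "eval_mpoly (p - q) x = eval_mpoly p x - eval_mpoly q x"
  and eval_scaleR [simp]: "eval_mpoly (c *\<^sub>R p) x = c *\<^sub>R eval_mpoly p x"
  and eval_zero [simp]: "eval_mpoly 0 x = 0"
  and eval_sum [simp]: "eval_mpoly (sum f A) x = (\<Sum>a\<in>A. eval_mpoly (f a) x)"
  and eval_one [simp]: "eval_mpoly 1 x = 1"
  by (simp_all add: eval_eq_lin_ext flip: single_one)

lemma eval_mult [simp]: "eval_mpoly (p * q) x = eval_mpoly p x * eval_mpoly q x"
proof -
  let ?f = "\<lambda>\<alpha>. \<Prod>i\<in>UNIV. (x $ i) ^ Poly_Mapping.lookup \<alpha> i"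
  have "?f (\<alpha> + \<beta>) = ?f \<alpha> * ?f \<beta>" for \<alpha> \<beta>
    by (simp add: lookup_add power_add prod.distrib)
  then show ?thesis
    unfolding eval_eq_lin_ext lin_ext_mult
    by (simp add: lin_ext_def sum_product scaleR_right.sum mult.commute[of "Poly_Mapping.lookup p _"])
qed

lemma eval_prod [simp]: "eval_mpoly (prod f A) x = (\<Prod>a\<in>A. eval_mpoly (f a) x)"
  by (induction A rule: infinite_finite_induct) simp_all

definition mvar :: "'n \<Rightarrow> ('n, real) mpoly"
  where "mvar i = Poly_Mapping.single (Poly_Mapping.single i 1) 1"

lemma eval_mvar [simp]: "eval_mpoly (mvar i) x = x $ i"
proof -
  have "(\<Prod>j\<in>UNIV. (x $ j) ^ Poly_Mapping.lookup (Poly_Mapping.single i 1) j)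
      = (\<Prod>j\<in>UNIV. if j = i then x $ j else 1)"
    by (rule prod.cong) (auto simp: lookup_single when_def)
  then show ?thesis by (simp add: eval_eq_lin_ext mvar_def)
qed

lemma eval_complex_point: "eval_mpoly p (complex_point x) = complex_of_real (eval_mpoly p x)"
  by (simp add: eval_mpoly_def complex_point_def)

lemma complex_point_eq_iff [simp]: "complex_point x = complex_point x' \<longleftrightarrow> x = x'"
  by (simp add: complex_point_def vec_eq_iff)

lemma real_variety_iff: "x \<in> real_variety J \<longleftrightarrow> (\<forall>p\<in>J. eval_mpoly p x = 0)"
  by (simp add: real_variety_def complex_variety_def eval_complex_point)

section \<open>Degree filtration\<close>

definition polys_le :: "nat \<Rightarrow> ('n::finite, real) mpoly set"
  where "polys_le s = {p. Poly_Mapping.keys p \<subseteq> monoms s}"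

lemma mdeg_add [simp]: "mdeg (\<alpha> + \<beta>) = mdeg \<alpha> + mdeg \<beta>"
  by (simp add: mdeg_def lookup_add sum.distrib)

lemma mdeg_zero [simp]: "mdeg 0 = 0"
  by (simp add: mdeg_def)

lemma mdeg_single [simp]: "mdeg (Poly_Mapping.single i c) = c"
  by (simp add: mdeg_def lookup_single when_def)

lemma zero_in_monoms [simp]: "0 \<in> monoms s"
  by (simp add: monoms_def)

lemma subspace_keys_subset: "subspace {p :: 'i \<Rightarrow>\<^sub>0 real. Poly_Mapping.keys p \<subseteq> A}"
  by (auto simp: subspace_def dest!: subsetD[OF keys_add] subsetD[OF keys_scaleR_subset])

lemma subspace_polys_le: "subspace (polys_le s)"
  unfolding polys_le_def by (rule subspace_keys_subset)

lemmas polys_le_closed = subspace_add[OF subspace_polys_le] subspace_diff[OF subspace_polys_le]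
  subspace_scale[OF subspace_polys_le] subspace_0[OF subspace_polys_le]
  subspace_sum[OF subspace_polys_le]

lemma single_in_polys_le [simp]:
  "\<alpha> \<in> monoms s \<Longrightarrow> Poly_Mapping.single \<alpha> c \<in> polys_le s"
  by (simp add: polys_le_def)

lemma one_in_polys_le [simp]: "1 \<in> polys_le s"
  by (simp add: polys_le_def)

lemma polys_le_mono: "s \<le> s' \<Longrightarrow> polys_le s \<subseteq> polys_le s'"
  by (auto simp: polys_le_def monoms_def)

lemma polys_le_mult: "p \<in> polys_le a \<Longrightarrow> q \<in> polys_le b \<Longrightarrow> p * q \<in> polys_le (a + b)"
  using keys_mult[of p q] by (fastforce simp: polys_le_def monoms_def)

lemma mvar_in_polys_le: "mvar i \<in> polys_le 1"
  by (simp add: mvar_def polys_le_def monoms_def)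

lemma mvar_mult_in_polys_le:
  "p \<in> polys_le (s - 1) \<Longrightarrow> 1 \<le> s \<Longrightarrow> mvar i * p \<in> polys_le s"
  using polys_le_mult[OF mvar_in_polys_le, of p "s - 1" i] by simp

lemma in_polys_le_tdeg: "p \<in> polys_le (tdeg p)"
  by (auto simp: polys_le_def monoms_def tdeg_def intro!: Max_ge)

lemma tdeg_le_half_deg: "tdeg p \<le> 2 * half_deg p"
proof -
  have "real (tdeg p) / 2 \<le> real (half_deg p)"
    unfolding half_deg_def by linarith
  then show ?thesis by linarith
qed

lemma in_polys_le_half_deg: "2 * half_deg p \<le> s \<Longrightarrow> p \<in> polys_le s"
  using in_polys_le_tdeg[of p] polys_le_mono[of "tdeg p" s] tdeg_le_half_deg[of p] by auto

lemma half_deg_le_max: "j \<in> {1..l} \<Longrightarrow> half_deg (h j) \<le> max_half_deg h l"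
  by (simp add: max_half_deg_def Max_ge)

lemma nonzero_monom_split:
  assumes "\<alpha> \<noteq> (0 :: 'n monom)"
  obtains i \<beta> where "\<alpha> = Poly_Mapping.single i 1 + \<beta>"
proof -
  obtain i where i: "Poly_Mapping.lookup \<alpha> i \<noteq> 0"
    using assms by (metis poly_mapping_eqI lookup_zero)
  have "\<alpha> = Poly_Mapping.single i 1 + (\<alpha> - Poly_Mapping.single i 1)"
    using i by (intro poly_mapping_eqI) (auto simp: lookup_add lookup_minus lookup_single when_def)
  then show ?thesis by (rule that)
qed

text \<open>Every polynomial of degree at most \<open>2 s\<close> is thereby a combination of products of two monomials
  of degree at most \<open>s\<close>, on which the extension of \<open>L\<close> can be compared with \<open>L\<close>.\<close>

lemma monom_split_mdeg:
  assumes "mdeg \<gamma> \<le> a + b"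
  obtains \<alpha> \<beta> :: "'n::finite monom" where "\<gamma> = \<alpha> + \<beta>" "mdeg \<alpha> \<le> a" "mdeg \<beta> \<le> b"
  using assms
proof (induction a arbitrary: \<gamma> thesis)
  case 0
  then show ?case by (metis add_0 mdeg_zero le_refl)
next
  case (Suc a)
  show ?case
  proof (cases "mdeg \<gamma> \<le> a + b")
    case True
    then show ?thesis using Suc by (metis le_SucI)
  next
    case False
    then have "\<gamma> \<noteq> 0" by auto
    then obtain i \<delta> where \<delta>: "\<gamma> = Poly_Mapping.single i 1 + \<delta>"
      by (rule nonzero_monom_split)
    with Suc.prems(2) have "mdeg \<delta> \<le> a + b" by simp
    then obtain \<alpha> \<beta> where "\<delta> = \<alpha> + \<beta>" "mdeg \<alpha> \<le> a" "mdeg \<beta> \<le> b"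
      using Suc.IH by blast
    then show ?thesis
      using Suc.prems(1)[of "Poly_Mapping.single i 1 + \<alpha>" \<beta>] \<delta> by (simp add: add.assoc)
  qed
qed

lemma single_monom_add:
  "Poly_Mapping.single (Poly_Mapping.single i 1 + \<beta>) (1::real) = mvar i * Poly_Mapping.single \<beta> 1"
  by (simp add: mvar_def mult_single)

lemma mult_closed_if_mvar_closed:
  fixes K :: "('n::finite, real) mpoly set"
  assumes "subspace K" "\<And>i p. p \<in> K \<Longrightarrow> mvar i * p \<in> K" "p \<in> K"
  shows "q * p \<in> K"
proof -
  have "Poly_Mapping.single \<alpha> 1 * p \<in> K" for \<alpha>
  proof (induction "mdeg \<alpha>" arbitrary: \<alpha> rule: less_induct)
    case less
    show ?case
    proof (cases "\<alpha> = 0")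
      case False
      then obtain i \<beta> where \<alpha>: "\<alpha> = Poly_Mapping.single i 1 + \<beta>"
        by (rule nonzero_monom_split)
      then show ?thesis
        using less[of \<beta>] assms(2) unfolding \<alpha> single_monom_add mult.assoc by simp
    qed (simp add: assms)
  qed
  moreover have "subspace {q. q * p \<in> K}"
    using assms(1) by (auto simp: subspace_def distrib_right)
  ultimately show ?thesis
    using mpoly_subspace_induct[of "{q. q * p \<in> K}" q] by simp
qed

section \<open>Ideals\<close>

lemma gen_ideal_superset: "A \<subseteq> gen_ideal A"
  unfolding gen_ideal_def by (rule module.span_superset[OF module_times])

lemma gen_ideal_mult: "p \<in> gen_ideal A \<Longrightarrow> q * p \<in> gen_ideal A"
  unfolding gen_ideal_def by (rule module.span_scale[OF module_times])

lemma gen_ideal_add: "p \<in> gen_ideal A \<Longrightarrow> q \<in> gen_ideal A \<Longrightarrow> p + q \<in> gen_ideal A"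
  unfolding gen_ideal_def by (rule module.span_add[OF module_times])

lemma gen_ideal_subset:
  assumes "A \<subseteq> K" "0 \<in> K" "\<And>p q. p \<in> K \<Longrightarrow> q \<in> K \<Longrightarrow> p + q \<in> K" "\<And>p q. p \<in> K \<Longrightarrow> q * p \<in> K"
  shows "gen_ideal A \<subseteq> K"
  unfolding gen_ideal_def using assms
  by (intro module.span_minimal[OF module_times]) (auto simp: module.subspace_def[OF module_times])

lemma subspace_if_ideal:
  fixes K :: "('n, real) mpoly set"
  assumes "0 \<in> K" "\<And>p q. p \<in> K \<Longrightarrow> q \<in> K \<Longrightarrow> p + q \<in> K" "\<And>p q. p \<in> K \<Longrightarrow> q * p \<in> K"
  shows "subspace K"
  unfolding subspace_def using assms(1,2) assms(3)[of _ "_ *\<^sub>R 1"] by auto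

lemma subspace_gen_ideal: "subspace (gen_ideal A :: ('n, real) mpoly set)"
  using gen_ideal_mult gen_ideal_add module.span_zero[OF module_times]
  by (intro subspace_if_ideal) (auto simp: gen_ideal_def)

lemma gen_ideal_subset_vanishing_ideal:
  "A \<subseteq> vanishing_ideal V \<Longrightarrow> gen_ideal A \<subseteq> vanishing_ideal V"
  by (rule gen_ideal_subset) (auto simp: vanishing_ideal_def)

section \<open>Ranks and kernels\<close>

text \<open>The ambient space of polynomials is infinite-dimensional, so finiteness is asked of \<open>W\<close> only.\<close>

lemma independent_card_ge_dim_spans:
  fixes T W :: "'a::real_vector set"
  assumes "independent T" "T \<subseteq> W" "W \<subseteq> span D" "finite D" "dim W \<le> card T"
  shows "W \<subseteq> span T"
proof -
  obtain B where B: "T \<subseteq> B" "B \<subseteq> W" "independent B" "W \<subseteq> span B"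
    using maximal_independent_subset_extend[OF assms(2,1)] by blast
  have "finite B"
    using independent_span_bound[OF assms(4) B(3)] B(2) assms(3) by auto
  moreover have "card B = dim W"
    using B by (intro basis_card_eq_dim) auto
  ultimately have "T = B"
    using B(1) assms(5) by (intro card_seteq) auto
  then show ?thesis using B(4) by simp
qed

text \<open>If \<open>f'\<close> kills no more of \<open>F\<close> than \<open>f\<close> does, then lifting a basis of \<open>f ` F\<close> to \<open>F\<close> and applying
  \<open>f'\<close> gives an independent set. If the rank of \<open>f'\<close> on the larger space \<open>F'\<close> does not exceed that of
  \<open>f\<close> on \<open>F\<close>, this set already spans \<open>f' ` F'\<close>. With \<open>F \<subset> F'\<close> the first conclusion turns equality of
  ranks into flatness; with \<open>F = F'\<close> the second turns maximality of the rank into an inclusion of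
  kernels.\<close>

lemma linear_rank_comparison:
  fixes f f' :: "'a::real_vector \<Rightarrow> 'b::real_vector"
  assumes lin: "linear f" "linear f'"
    and sub: "subspace F" "subspace F'" "F \<subseteq> F'"
    and fin: "F' \<subseteq> span D" "finite D"
    and ker: "\<And>p. p \<in> F \<Longrightarrow> f' p = 0 \<Longrightarrow> f p = 0"
    and rank: "dim (f' ` F') \<le> dim (f ` F)"
  shows "\<And>p. p \<in> F' \<Longrightarrow> \<exists>q\<in>F. f' (p - q) = 0"
    and "\<And>p. p \<in> F \<Longrightarrow> f p = 0 \<Longrightarrow> f' p = 0"
proof -
  obtain B where B: "B \<subseteq> f ` F" "independent B" "f ` F \<subseteq> span B" "card B = dim (f ` F)"
    by (rule basis_exists)
  define g0 where "g0 b = (SOME p. p \<in> F \<and> f p = b)" for b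
  have g0: "g0 b \<in> F \<and> f (g0 b) = b" if "b \<in> B" for b
    unfolding g0_def by (rule someI_ex) (use that B(1) in auto)
  obtain g where g: "linear g" "\<And>b. b \<in> B \<Longrightarrow> g b = g0 b"
    using linear_independent_extend[OF B(2), of g0] by blast
  have gF: "g v \<in> F" if "v \<in> span B" for v
  proof -
    have "g ` span B = span (g ` B)" by (simp add: linear_span_image g(1))
    also have "\<dots> \<subseteq> F" using g0 g(2) by (intro span_minimal sub(1)) auto
    finally show ?thesis using that by auto
  qed
  have fg: "f (g v) = v" if "v \<in> span B" for v
    using linear_eq_on[OF linear_compose[OF g(1) lin(1)] linear_id that] g0 g(2) by simp
  have lin': "linear (f' \<circ> g)" by (rule linear_compose[OF g(1) lin(2)])
  have inj: "inj_on (f' \<circ> g) (span B)"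
    unfolding linear_inj_on_iff_eq_0[OF lin' subspace_span]
    using ker[OF gF] fg by auto
  have span': "f' ` F' \<subseteq> span ((f' \<circ> g) ` B)"
  proof (rule independent_card_ge_dim_spans)
    show "independent ((f' \<circ> g) ` B)"
      by (rule linear_independent_injective_image[OF lin' B(2) inj])
    show "(f' \<circ> g) ` B \<subseteq> f' ` F'"
      using gF[OF span_base] sub(3) by auto
    show "f' ` F' \<subseteq> span (f' ` D)"
      using fin(1) by (auto simp: linear_span_image[OF lin(2)])
    have "card ((f' \<circ> g) ` B) = card B"
      using inj by (intro card_image) (meson inj_on_subset span_superset)
    then show "dim (f' ` F') \<le> card ((f' \<circ> g) ` B)"
      using rank B(4) by simp
  qed (use fin in auto)
  have ex: "\<exists>v\<in>span B. f' p = f' (g v)" if "p \<in> F'" for p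
    using subsetD[OF span' imageI[OF that]] unfolding linear_span_image[OF lin'] by auto
  show "\<exists>q\<in>F. f' (p - q) = 0" if "p \<in> F'" for p
    using ex[OF that] gF by (auto simp: linear_diff[OF lin(2)])
  show "f' p = 0" if p: "p \<in> F" "f p = 0" for p
  proof -
    obtain v where v: "v \<in> span B" "f' p = f' (g v)"
      using ex p sub(3) by blast
    then have "f (p - g v) = 0"
      using p gF by (intro ker) (auto simp: linear_diff[OF lin(2)] subspace_diff[OF sub(1)])
    then have "v = 0" using p v fg by (simp add: linear_diff[OF lin(1)])
    then show ?thesis using v by (simp add: linear_0 lin g)
  qed
qed

lemma keys_subset_eq_span:
  "{p :: 'i \<Rightarrow>\<^sub>0 real. Poly_Mapping.keys p \<subseteq> A} = span ((\<lambda>a. Poly_Mapping.single a 1) ` A)"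
proof
  show "{p :: 'i \<Rightarrow>\<^sub>0 real. Poly_Mapping.keys p \<subseteq> A} \<subseteq> span ((\<lambda>a. Poly_Mapping.single a 1) ` A)"
  proof clarify
    fix p :: "'i \<Rightarrow>\<^sub>0 real"
    assume "Poly_Mapping.keys p \<subseteq> A"
    then show "p \<in> span ((\<lambda>a. Poly_Mapping.single a 1) ` A)"
      by (intro mpoly_subspace_induct[OF subspace_span, of p]) (auto intro: span_base)
  qed
  show "span ((\<lambda>a. Poly_Mapping.single a 1) ` A) \<subseteq> {p :: 'i \<Rightarrow>\<^sub>0 real. Poly_Mapping.keys p \<subseteq> A}"
    by (intro span_minimal subspace_keys_subset) auto
qed

abbreviation mat_apply :: "'i set \<Rightarrow> ('i \<Rightarrow> 'i \<Rightarrow> real) \<Rightarrow> ('i \<Rightarrow>\<^sub>0 real) \<Rightarrow> ('i \<Rightarrow>\<^sub>0 real)"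
  where "mat_apply A M \<equiv> lin_ext (mat_column A M)"

lemma mat_rank_eq_dim_image:
  "mat_rank A M = dim (mat_apply A M ` {p. Poly_Mapping.keys p \<subseteq> A})"
  by (simp add: mat_rank_def keys_subset_eq_span image_image flip: linear_span_image[OF linear_lin_ext])

lemma mat_kernel_iff:
  assumes "finite A" "Poly_Mapping.keys p \<subseteq> A"
  shows "p \<in> mat_kernel A M \<longleftrightarrow> mat_apply A M p = 0"
proof -
  have "Poly_Mapping.lookup (mat_apply A M p) i =
      (if i \<in> A then (\<Sum>j\<in>A. M i j * Poly_Mapping.lookup p j) else 0)" for i
    using assms by (simp add: lin_ext_superset[OF assms] lookup_sum lookup_mat_column mult.commute)
  then show ?thesis
    using assms by (auto simp: mat_kernel_def poly_mapping_eq_iff fun_eq_iff)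
qed

lemma polys_le_eq_span: "polys_le s = span ((\<lambda>a. Poly_Mapping.single a 1) ` monoms s)"
  by (simp add: polys_le_def keys_subset_eq_span)

abbreviation moment_map :: "nat \<Rightarrow> ('n::finite monom \<Rightarrow> real) \<Rightarrow> ('n, real) mpoly \<Rightarrow> ('n, real) mpoly"
  where "moment_map s y \<equiv> mat_apply (monoms s) (moment_mat y)"

lemma moment_rank_eq_dim: "moment_rank s y = dim (moment_map s y ` polys_le s)"
  by (simp add: moment_rank_def mat_rank_eq_dim_image polys_le_def)

lemma moment_map_eq_0_iff:
  "p \<in> polys_le s \<Longrightarrow> moment_map s y p = 0 \<longleftrightarrow> p \<in> moment_kernel s y"
  by (simp add: moment_kernel_def mat_kernel_iff polys_le_def)

lemma moment_rank_comparison: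
  fixes y z :: "'n::finite monom \<Rightarrow> real"
  assumes "r \<le> s" "moment_kernel s z \<inter> polys_le r \<subseteq> moment_kernel r y"
    and "moment_rank s z \<le> moment_rank r y"
  shows "p \<in> polys_le s \<Longrightarrow> \<exists>q\<in>polys_le r. p - q \<in> moment_kernel s z"
    and "moment_kernel r y \<subseteq> moment_kernel s z"
proof -
  note rs = polys_le_mono[OF assms(1)]
  have ker: "moment_map r y p = 0" if "p \<in> polys_le r" "moment_map s z p = 0" for p
    using that rs assms(2) moment_map_eq_0_iff[of p s z] moment_map_eq_0_iff[of p r y] by auto
  have fin: "polys_le s \<subseteq> span ((\<lambda>a. Poly_Mapping.single a 1) ` monoms s)"
    "finite ((\<lambda>a. Poly_Mapping.single a (1::real)) ` (monoms s :: 'n monom set))"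
    by (simp_all add: polys_le_eq_span)
  note cmp = linear_rank_comparison[OF linear_lin_ext linear_lin_ext subspace_polys_le
      subspace_polys_le rs fin ker assms(3)[unfolded moment_rank_eq_dim]]
  show "\<exists>q\<in>polys_le r. p - q \<in> moment_kernel s z" if "p \<in> polys_le s"
  proof -
    from cmp(1)[OF _ _ that] obtain q where q: "q \<in> polys_le r" "moment_map s z (p - q) = 0"
      by blast
    moreover have "p - q \<in> polys_le s" using that q rs polys_le_closed by blast
    ultimately show ?thesis using moment_map_eq_0_iff by blast
  qed
  show "moment_kernel r y \<subseteq> moment_kernel s z"
  proof
    fix p assume p: "p \<in> moment_kernel r y"
    then have "p \<in> polys_le r" by (simp add: moment_kernel_def mat_kernel_def polys_le_def)
    then show "p \<in> moment_kernel s z"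
      using cmp(2)[of p] p rs moment_map_eq_0_iff[of p r y] moment_map_eq_0_iff[of p s z] by auto
  qed
qed

section \<open>Moment matrices as bilinear forms\<close>

lemma lin_ext_cong:
  "(\<And>a. a \<in> Poly_Mapping.keys p \<Longrightarrow> f a = g a) \<Longrightarrow> lin_ext f p = lin_ext g p"
  by (simp add: lin_ext_def)

lemma lin_ext_mult_moment:
  assumes "p \<in> polys_le a" "q \<in> polys_le b"
  shows "lin_ext y (p * q) = (\<Sum>\<alpha>\<in>monoms a. \<Sum>\<beta>\<in>monoms b.
    Poly_Mapping.lookup p \<alpha> * moment_mat y \<alpha> \<beta> * Poly_Mapping.lookup q \<beta>)"
  using assms
  by (simp add: lin_ext_mult lin_ext_superset[of "monoms _"] polys_le_def moment_mat_def
      sum_distrib_left mult_ac)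

lemma lin_ext_shift_seq: "lin_ext (shift_seq h y) p = lin_ext y (h * p)"
proof -
  have "shift_seq h y \<alpha> = lin_ext (\<lambda>\<beta>. y (\<alpha> + \<beta>)) h" for \<alpha>
    by (simp add: shift_seq_def lin_ext_def)
  then have "lin_ext (shift_seq h y) p = lin_ext (\<lambda>\<alpha>. lin_ext (\<lambda>\<beta>. y (\<alpha> + \<beta>)) h) p"
    by presburger
  then show ?thesis by (simp add: mult.commute[of h] lin_ext_mult)
qed

lemma moment_kernel_iff:
  "p \<in> moment_kernel s y \<longleftrightarrow> p \<in> polys_le s \<and> (\<forall>q\<in>polys_le s. lin_ext y (q * p) = 0)"
proof
  assume p: "p \<in> moment_kernel s y"
  then have "p \<in> polys_le s" by (simp add: moment_kernel_def mat_kernel_def polys_le_def)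
  then show "p \<in> polys_le s \<and> (\<forall>q\<in>polys_le s. lin_ext y (q * p) = 0)"
    using p by (auto simp: lin_ext_mult_moment moment_kernel_def mat_kernel_def mult.assoc
        simp flip: sum_distrib_left)
next
  assume p: "p \<in> polys_le s \<and> (\<forall>q\<in>polys_le s. lin_ext y (q * p) = 0)"
  have "(\<Sum>\<beta>\<in>monoms s. moment_mat y \<alpha> \<beta> * Poly_Mapping.lookup p \<beta>) = 0" if "\<alpha> \<in> monoms s" for \<alpha>
  proof -
    have "lin_ext y (Poly_Mapping.single \<alpha> 1 * p) = 0" using p that by simp
    then have "lin_ext (\<lambda>\<beta>. y (\<alpha> + \<beta>)) p = 0" by (simp add: lin_ext_mult)
    then show ?thesis
      using p lin_ext_superset[of "monoms s" p "\<lambda>\<beta>. y (\<alpha> + \<beta>)"]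
      by (simp add: polys_le_def moment_mat_def mult.commute)
  qed
  then show "p \<in> moment_kernel s y"
    using p by (simp add: moment_kernel_def mat_kernel_def polys_le_def)
qed

lemma moment_psd_iff:
  "mat_psd (monoms a) (moment_mat z) \<longleftrightarrow> (\<forall>q\<in>polys_le a. 0 \<le> lin_ext z (q * q))"
proof
  assume "mat_psd (monoms a) (moment_mat z)"
  then show "\<forall>q\<in>polys_le a. 0 \<le> lin_ext z (q * q)"
    by (auto simp: lin_ext_mult_moment mat_psd_def)
next
  assume psd: "\<forall>q\<in>polys_le a. 0 \<le> lin_ext z (q * q)"
  have "0 \<le> (\<Sum>\<alpha>\<in>monoms a. \<Sum>\<beta>\<in>monoms a. v \<alpha> * moment_mat z \<alpha> \<beta> * v \<beta>)" for v
  proof -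
    define q where "q = (\<Sum>\<alpha>\<in>monoms a. Poly_Mapping.single \<alpha> (v \<alpha>))"
    have q: "q \<in> polys_le a"
      unfolding q_def by (intro polys_le_closed) simp
    have "Poly_Mapping.lookup q \<alpha> = v \<alpha>" if "\<alpha> \<in> monoms a" for \<alpha>
      using that by (simp add: q_def lookup_sum lookup_single when_def)
    then show ?thesis
      using psd[rule_format, OF q] by (simp add: lin_ext_mult_moment[OF q q])
  qed
  then show "mat_psd (monoms a) (moment_mat z)"
    by (simp add: mat_psd_def moment_mat_def add.commute)
qed

lemma moment_zero_iff:
  "mat_zero (monoms a) (moment_mat z) \<longleftrightarrow> (\<forall>p\<in>polys_le a. \<forall>q\<in>polys_le a. lin_ext z (p * q) = 0)"
proof
  assume "mat_zero (monoms a) (moment_mat z)"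
  then show "\<forall>p\<in>polys_le a. \<forall>q\<in>polys_le a. lin_ext z (p * q) = 0"
    by (auto simp: lin_ext_mult_moment mat_zero_def)
next
  assume *: "\<forall>p\<in>polys_le a. \<forall>q\<in>polys_le a. lin_ext z (p * q) = 0"
  have "moment_mat z \<alpha> \<beta> = 0" if "\<alpha> \<in> monoms a" "\<beta> \<in> monoms a" for \<alpha> \<beta>
    using *[rule_format, of "Poly_Mapping.single \<alpha> 1" "Poly_Mapping.single \<beta> 1"] that
    by (simp add: mult_single moment_mat_def)
  then show "mat_zero (monoms a) (moment_mat z)"
    by (simp add: mat_zero_def)
qed

lemma K_set_iff:
  "y \<in> K_set h m k t \<longleftrightarrow>
    y \<in> extensional (monoms (2 * t)) \<and> y 0 = 1 \<and>
    (\<forall>q\<in>polys_le t. 0 \<le> lin_ext y (q * q)) \<and>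
    (\<forall>j\<in>{1..m}. \<forall>p\<in>polys_le (t - half_deg (h j)). \<forall>q\<in>polys_le (t - half_deg (h j)).
       lin_ext y (h j * (p * q)) = 0) \<and>
    (\<forall>j\<in>{m+1..m+k}. \<forall>q\<in>polys_le (t - half_deg (h j)). 0 \<le> lin_ext y (h j * (q * q)))"
  by (auto simp: K_set_def moment_psd_iff moment_zero_iff lin_ext_shift_seq PiE_def)

text \<open>Isotropic vectors of a positive semidefinite form lie in its radical: otherwise the quadratic
  polynomial \<open>c \<mapsto> L ((p + c q)\<^sup>2)\<close>, which has no constant term, would have a negative value.\<close>

lemma psd_form_null:
  fixes L :: "('n, real) mpoly \<Rightarrow> real"
  assumes "linear L" "subspace F" "\<And>q. q \<in> F \<Longrightarrow> 0 \<le> L (q * q)"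
    and "p \<in> F" "L (p * p) = 0" "q \<in> F"
  shows "L (q * p) = 0"
proof (rule ccontr)
  assume ne: "L (q * p) \<noteq> 0"
  let ?a = "L (q * q)" and ?b = "L (q * p)"
  have a: "0 \<le> ?a" using assms by blast
  \<comment> \<open>The minimum is at \<open>- ?b / ?a\<close>; adding 1 also covers \<open>?a = 0\<close>.\<close>
  define c where "c = - ?b / (?a + 1)"
  have b: "?b = - c * (?a + 1)" using a by (simp add: c_def)
  have "c \<noteq> 0" using ne a by (simp add: c_def)
  have expand: "(p + c *\<^sub>R q) * (p + c *\<^sub>R q) = p * p + (c *\<^sub>R (q * p) + (c *\<^sub>R (q * p) + (c * c) *\<^sub>R (q * q)))"
    by (simp only: distrib_left distrib_right mpoly_scaleR_mult_left mpoly_scaleR_mult_right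
        scaleR_scaleR scaleR_add_right mult.commute[of p q] add_ac)
  have "p + c *\<^sub>R q \<in> F" using assms by (simp add: subspace_add subspace_scale)
  then have "0 \<le> L ((p + c *\<^sub>R q) * (p + c *\<^sub>R q))" by (rule assms(3))
  also have "\<dots> = 2 * c * ?b + c * c * ?a"
    unfolding expand linear_add[OF assms(1)] linear_scale[OF assms(1)] assms(5) by simp
  also have "\<dots> = - (c * c) * (?a + 2)"
    by (subst b) (simp add: algebra_simps)
  also have "\<dots> < 0"
    using a \<open>c \<noteq> 0\<close> by (intro mult_neg_pos) (simp_all add: zero_less_mult_iff linorder_neq_iff disj_commute)
  finally show False by simp
qed

lemma moment_kernel_iff_null:
  assumes "\<And>q. q \<in> polys_le s \<Longrightarrow> 0 \<le> lin_ext y (q * q)"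
  shows "p \<in> moment_kernel s y \<longleftrightarrow> p \<in> polys_le s \<and> lin_ext y (p * p) = 0"
  unfolding moment_kernel_iff
  using psd_form_null[OF linear_lin_ext subspace_polys_le assms] by blast

lemma moment_kernel_Int_polys_le:
  assumes "\<And>q. q \<in> polys_le t \<Longrightarrow> 0 \<le> lin_ext y (q * q)" "s \<le> t"
  shows "moment_kernel t y \<inter> polys_le s = moment_kernel s y"
proof -
  have "0 \<le> lin_ext y (q * q)" if "q \<in> polys_le s" for q
    using that assms(1) polys_le_mono[OF assms(2)] by blast
  then show ?thesis
    using polys_le_mono[OF assms(2)] by (auto simp: moment_kernel_iff_null[of _ y] assms(1))
qed

section \<open>Maximal rank\<close>

text \<open>A polynomial in the kernel of the averaged sequence \<open>z\<close> satisfies \<open>L (q\<^sup>2) + q(x)\<^sup>2 = 0\<close>, so it lies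
  in the kernel of \<open>y\<close>. Maximality of the rank of \<open>y\<close> reverses this inclusion, and then the same
  equation shows that the kernel of \<open>y\<close> vanishes at \<open>x\<close>.\<close>

lemma max_rank_kernel_vanishes:
  fixes x :: "real ^ 'n::finite"
  assumes deg: "\<And>j. j \<in> {1..m + k} \<Longrightarrow> half_deg (h j) \<le> t"
    and y: "y \<in> K_set h m k t"
    and max: "\<And>z. z \<in> K_set h m k t \<Longrightarrow> moment_rank t z \<le> moment_rank t y"
    and eq: "\<And>j. j \<in> {1..m} \<Longrightarrow> eval_mpoly (h j) x = 0"
    and ge: "\<And>j. j \<in> {m+1..m+k} \<Longrightarrow> 0 \<le> eval_mpoly (h j) x"
    and p: "p \<in> moment_kernel t y"
  shows "eval_mpoly p x = 0"
proof -
  define z where "z = restrict (\<lambda>\<alpha>. (y \<alpha> + (\<Prod>i\<in>UNIV. (x $ i) ^ Poly_Mapping.lookup \<alpha> i)) / 2)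
    (monoms (2 * t))"
  have z: "lin_ext z p = (lin_ext y p + eval_mpoly p x) / 2" if "p \<in> polys_le (2 * t)" for p
  proof -
    have "lin_ext z p = lin_ext (\<lambda>\<alpha>. (y \<alpha> + (\<Prod>i\<in>UNIV. (x $ i) ^ Poly_Mapping.lookup \<alpha> i)) / 2) p"
      using that by (intro lin_ext_cong) (auto simp: z_def polys_le_def)
    then show ?thesis
      by (simp add: eval_eq_lin_ext lin_ext_def sum.distrib add_divide_distrib distrib_left
          flip: sum_divide_distrib)
  qed
  have sq: "p * q \<in> polys_le (2 * t)" if "p \<in> polys_le t" "q \<in> polys_le t" for p q :: "('n, real) mpoly"
    using polys_le_mult[OF that] by (simp add: mult_2)
  have hsq: "h j * (p * q) \<in> polys_le (2 * t)"
    if "j \<in> {1..m + k}" "p \<in> polys_le (t - half_deg (h j))" "q \<in> polys_le (t - half_deg (h j))" for j p q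
    using polys_le_mult[OF in_polys_le_half_deg[OF order_refl, of "h j"] polys_le_mult[OF that(2,3)]]
      deg[OF that(1)] by (simp add: algebra_simps)
  note Y = y[unfolded K_set_iff]
  have Ysq: "0 \<le> lin_ext y (q * q)" if "q \<in> polys_le t" for q using Y that by blast
  have Zsq: "0 \<le> lin_ext z (q * q)" if "q \<in> polys_le t" for q
    using Ysq[OF that] by (simp add: z sq that)
  have ext: "z \<in> extensional (monoms (2 * t))" by (simp add: z_def)
  have "z 0 = 1" using Y by (simp add: z_def)
  then have zK: "z \<in> K_set h m k t"
    unfolding K_set_iff using Y Zsq eq ge ext by (auto simp: z hsq)
  have "moment_kernel t z \<inter> polys_le t \<subseteq> moment_kernel t y"
  proof
    fix q assume "q \<in> moment_kernel t z \<inter> polys_le t"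
    then have q: "q \<in> polys_le t" "lin_ext y (q * q) + eval_mpoly q x * eval_mpoly q x = 0"
      by (auto simp: moment_kernel_iff z sq)
    then have "lin_ext y (q * q) = 0"
      using Ysq[OF q(1)] zero_le_square[of "eval_mpoly q x"] by linarith
    then show "q \<in> moment_kernel t y"
      using q Ysq by (simp add: moment_kernel_iff_null)
  qed
  then have "moment_kernel t y \<subseteq> moment_kernel t z"
    by (rule moment_rank_comparison(2)[OF order_refl _ max[OF zK]])
  then have "p \<in> moment_kernel t z" using p by blast
  then have "p \<in> polys_le t" "lin_ext z (p * p) = 0" by (simp_all add: moment_kernel_iff)
  then have "eval_mpoly p x * eval_mpoly p x = 0"
    using Ysq[of p] zero_le_square[of "eval_mpoly p x"] by (simp add: z sq add_nonneg_eq_0_iff)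
  then show ?thesis by simp
qed

section \<open>Flat extension\<close>

text \<open>A linear normal form modulo \<open>N\<close> with values in \<open>V\<close>. Working with representatives in \<open>V\<close> instead
  of cosets keeps the operators below on the type of polynomials; it needs a projection that is
  linear and kills \<open>N\<close>, so it is built from a basis of \<open>N\<close> extended inside \<open>N \<union> V\<close>.\<close>

lemma projection_onto_complement:
  fixes N V :: "'a::real_vector set"
  assumes "subspace N" "subspace V"
  obtains \<pi> where "linear \<pi>" "\<And>p. p \<in> N \<Longrightarrow> \<pi> p = 0"
    "\<And>p q. q \<in> V \<Longrightarrow> p - q \<in> N \<Longrightarrow> \<pi> p \<in> V \<and> p - \<pi> p \<in> N"
proof -
  obtain C where C: "C \<subseteq> N" "independent C" "N \<subseteq> span C"
    using maximal_independent_subset by blast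
  obtain D where D: "C \<subseteq> D" "D \<subseteq> N \<union> V" "independent D" "N \<union> V \<subseteq> span D"
    using maximal_independent_subset_extend[of C "N \<union> V"] C by blast
  obtain \<pi> where \<pi>: "linear \<pi>" "\<And>b. b \<in> D \<Longrightarrow> \<pi> b = (if b \<in> C then 0 else b)"
    using linear_independent_extend[OF D(3), of "\<lambda>b. if b \<in> C then 0 else b"] by blast
  have DV: "b \<in> V" if "b \<in> D - C" for b
  proof (rule ccontr)
    assume "b \<notin> V"
    then have "b \<in> span C" using that D(2) C(3) by blast
    then have "b \<in> span (D - {b})"
      using span_mono[of C "D - {b}"] D(1) that by blast
    then show False using D(3) that by (auto simp: dependent_def)
  qed
  have kill: "\<pi> p = 0" if "p \<in> N" for p
  proof (rule linear_eq_0_on_span[OF \<pi>(1)])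
    show "\<pi> b = 0" if "b \<in> C" for b using \<pi>(2) D(1) that by auto
  qed (use that C(3) in auto)
  have diff: "p - \<pi> p \<in> N" if "p \<in> span D" for p
    using that
  proof (induction rule: span_induct_alt)
    case base
    then show ?case using assms(1) by (simp add: linear_0[OF \<pi>(1)] subspace_0)
  next
    case (step c b p)
    have "b - \<pi> b \<in> N" using \<pi>(2)[OF step(1)] C(1) assms(1) by (auto simp: subspace_0)
    then have "c *\<^sub>R (b - \<pi> b) + (p - \<pi> p) \<in> N"
      using step assms(1) by (simp add: subspace_add subspace_scale)
    then show ?case
      by (simp add: linear_add[OF \<pi>(1)] linear_scale[OF \<pi>(1)] scaleR_diff_right algebra_simps)
  qed
  have inV: "\<pi> p \<in> V" if "p \<in> span D" for p
    using that
  proof (induction rule: span_induct_alt)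
    case base
    then show ?case using assms(2) by (simp add: linear_0[OF \<pi>(1)] subspace_0)
  next
    case (step c b p)
    have "\<pi> b \<in> V" using \<pi>(2)[OF step(1)] DV[of b] step(1) assms(2) by (auto simp: subspace_0)
    then show ?case
      using step assms(2)
      by (simp add: linear_add[OF \<pi>(1)] linear_scale[OF \<pi>(1)] subspace_add subspace_scale)
  qed
  have "p \<in> span D" if "q \<in> V" "p - q \<in> N" for p q
  proof -
    have "(p - q) + q \<in> span D" using that D(4) by (intro span_add) auto
    then show ?thesis by simp
  qed
  then show ?thesis using that[OF \<pi>(1) kill] inV diff by blast
qed


text \<open>The monomial \<open>\<alpha>\<close> is turned into a composition of the \<open>X i\<close> by peeling off one variable at a
  time. Commutativity makes the result independent of the order: if the variable peeled off first is
  some \<open>j \<noteq> i\<close>, then \<open>i\<close> can be peeled off next, and the two steps can be interchanged. The set \<open>B\<close> is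
  needed since the operators in question commute only on the normal forms.\<close>

lemma commuting_operators_monom:
  fixes X :: "'n::finite \<Rightarrow> 'b \<Rightarrow> 'b" and b :: 'b
  assumes closed: "b \<in> B" "\<And>i v. v \<in> B \<Longrightarrow> X i v \<in> B"
    and comm: "\<And>i j v. v \<in> B \<Longrightarrow> X i (X j v) = X j (X i v)"
  shows "\<exists>T :: 'n monom \<Rightarrow> 'b. T 0 = b \<and> (\<forall>\<alpha>. T \<alpha> \<in> B) \<and>
    (\<forall>i \<alpha>. T (Poly_Mapping.single i 1 + \<alpha>) = X i (T \<alpha>))"
proof -
  let ?e = "\<lambda>i. Poly_Mapping.single i (1::nat) :: 'n monom"
  define c where "c \<alpha> = (SOME i. Poly_Mapping.lookup \<alpha> i \<noteq> 0)" for \<alpha> :: "'n monom"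
  define T0 :: "nat \<Rightarrow> 'n monom \<Rightarrow> 'b" where
    "T0 = rec_nat (\<lambda>_. b) (\<lambda>_ f \<alpha>. X (c \<alpha>) (f (\<alpha> - ?e (c \<alpha>))))"
  define T where "T \<alpha> = T0 (mdeg \<alpha>) \<alpha>" for \<alpha>
  have T_0: "T 0 = b" by (simp add: T_def T0_def)
  have T_step: "\<exists>i \<beta>. \<alpha> = ?e i + \<beta> \<and> T \<alpha> = X i (T \<beta>)" if "\<alpha> \<noteq> 0" for \<alpha>
  proof -
    have "\<exists>i. Poly_Mapping.lookup \<alpha> i \<noteq> 0"
      using that by (metis poly_mapping_eqI lookup_zero)
    then have c: "Poly_Mapping.lookup \<alpha> (c \<alpha>) \<noteq> 0"
      unfolding c_def by (rule someI_ex)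
    have \<alpha>: "\<alpha> = ?e (c \<alpha>) + (\<alpha> - ?e (c \<alpha>))"
      using c by (intro poly_mapping_eqI) (auto simp: lookup_add lookup_minus lookup_single when_def)
    have "mdeg \<alpha> = mdeg (?e (c \<alpha>)) + mdeg (\<alpha> - ?e (c \<alpha>))"
      by (subst \<alpha>, subst mdeg_add) (rule refl)
    then have "T \<alpha> = X (c \<alpha>) (T (\<alpha> - ?e (c \<alpha>)))"
      by (simp add: T_def T0_def)
    then show ?thesis using \<alpha> by blast
  qed
  have T_B: "T \<alpha> \<in> B" for \<alpha>
  proof (induction "mdeg \<alpha>" arbitrary: \<alpha> rule: less_induct)
    case less
    show ?case
    proof (cases "\<alpha> = 0")
      case False
      then obtain i \<beta> where "\<alpha> = ?e i + \<beta>" "T \<alpha> = X i (T \<beta>)" using T_step by blast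
      then show ?thesis using less[of \<beta>] closed(2) by simp
    qed (simp add: T_0 closed)
  qed
  have "T (?e i + \<alpha>) = X i (T \<alpha>)" for i \<alpha>
  proof (induction "mdeg \<alpha>" arbitrary: i \<alpha> rule: less_induct)
    case less
    have "?e i + \<alpha> \<noteq> 0" by (metis mdeg_add mdeg_single mdeg_zero add_is_0 one_neq_zero)
    then obtain j \<beta> where j: "?e i + \<alpha> = ?e j + \<beta>" "T (?e i + \<alpha>) = X j (T \<beta>)"
      using T_step by blast
    show ?case
    proof (cases "i = j")
      case True
      then show ?thesis using j by simp
    next
      case False
      define \<gamma> where "\<gamma> = \<alpha> - ?e j"
      have *: "Poly_Mapping.lookup (?e i) k + Poly_Mapping.lookup \<alpha> k =
          Poly_Mapping.lookup (?e j) k + Poly_Mapping.lookup \<beta> k" for k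
        using j(1) by (metis lookup_add)
      have \<alpha>: "\<alpha> = ?e j + \<gamma>" and \<beta>: "\<beta> = ?e i + \<gamma>"
        unfolding \<gamma>_def using False *
        by (intro poly_mapping_eqI; force simp: lookup_add lookup_minus lookup_single when_def split: if_splits)+
      have "mdeg \<gamma> < mdeg \<alpha>" by (simp add: \<alpha>)
      then have "T \<beta> = X i (T \<gamma>)" "T \<alpha> = X j (T \<gamma>)"
        using less unfolding \<alpha> \<beta> by blast+
      then show ?thesis using j(2) comm[OF T_B] by simp
    qed
  qed
  then show ?thesis using T_0 T_B by blast
qed

text \<open>The flat extension theorem of Curto and Fialkow, in the form of the existence of a positive
  functional \<open>\<Lambda>\<close> on all polynomials, strictly positive modulo the ideal generated by \<open>N\<close>. Multiplication
  by a variable raises the degree by one, and flatness is what allows to return to degree \<open>s - 1\<close>. Let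
  \<open>\<pi>\<close> be the normal form modulo \<open>N\<close>. The operators \<open>X i p = \<pi> (x\<^sub>i p)\<close> are symmetric for the form \<open>L (p * q)\<close>
  and commute, so they define \<open>\<phi> p = p(X) (\<pi> 1)\<close>, a normal form for all polynomials modulo the ideal;
  \<open>\<Lambda>\<close> is \<open>L\<close> evaluated through \<open>\<phi>\<close>.\<close>

lemma flat_extension:
  fixes L :: "('n::finite, real) mpoly \<Rightarrow> real"
  assumes L: "linear L" and s: "1 \<le> s"
    and psd: "\<And>q. q \<in> polys_le s \<Longrightarrow> 0 \<le> L (q * q)"
    and N: "N = {p \<in> polys_le s. \<forall>q\<in>polys_le s. L (q * p) = 0}"
    and flat: "\<And>p. p \<in> polys_le s \<Longrightarrow> \<exists>q\<in>polys_le (s - 1). p - q \<in> N"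
  obtains \<Lambda> where "linear \<Lambda>" "\<And>p. p \<in> polys_le (2 * s) \<Longrightarrow> \<Lambda> p = L p"
    "\<And>p. p \<in> gen_ideal N \<Longrightarrow> \<Lambda> p = 0" "\<And>p. 0 \<le> \<Lambda> (p * p)"
    "\<And>p. \<Lambda> (p * p) = 0 \<Longrightarrow> p \<in> gen_ideal N"
    "\<And>p. \<exists>q\<in>polys_le (s - 1). p - q \<in> gen_ideal N"
proof -
  let ?B = "polys_le (s - 1) :: ('n, real) mpoly set"
  have B_sub: "?B \<subseteq> polys_le s" by (rule polys_le_mono) simp
  have subN: "subspace N"
    using subspace_polys_le[of s] unfolding N
    by (auto simp: subspace_def distrib_left linear_add[OF L] linear_scale[OF L] linear_0[OF L])
  obtain \<pi> where \<pi>: "linear \<pi>" "\<And>p. p \<in> N \<Longrightarrow> \<pi> p = 0"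
    and \<pi>': "\<And>p q. q \<in> ?B \<Longrightarrow> p - q \<in> N \<Longrightarrow> \<pi> p \<in> ?B \<and> p - \<pi> p \<in> N"
    using projection_onto_complement[OF subN subspace_polys_le] by blast
  have \<pi>B: "\<pi> p \<in> ?B" and \<pi>N: "p - \<pi> p \<in> N" if "p \<in> polys_le s" for p
    using flat[OF that] \<pi>' by blast+
  have LN: "L (p * n) = 0" "L (n * p) = 0" if "n \<in> N" "p \<in> polys_le s" for n p
    using that unfolding N by (auto simp: mult.commute[of n])
  have L_cong: "L (p * q) = L (p' * q)" if "p - p' \<in> N" "q \<in> polys_le s" for p p' q
  proof -
    have "L ((p - p') * q) = 0" using LN that by blast
    then show ?thesis by (simp add: left_diff_distrib linear_diff[OF L])
  qed
  have \<pi>_idem: "\<pi> (\<pi> p) = \<pi> p" if "p \<in> polys_le s" for p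
    using \<pi>(2)[OF \<pi>N[OF that]] by (simp add: linear_diff[OF \<pi>(1)])
  have xB: "mvar i * p \<in> polys_le s" if "p \<in> ?B" for i p
    using mvar_mult_in_polys_le[OF that s] .
  define X where "X i p = \<pi> (mvar i * p)" for i p
  have XB: "X i p \<in> ?B" if "p \<in> ?B" for i p
    unfolding X_def by (intro \<pi>B xB that)
  have X_sym: "L (X i p * q) = L (p * X i q)" if "p \<in> ?B" "q \<in> ?B" for i p q
  proof -
    have "L (X i p * q) = L (mvar i * p * q)"
      using L_cong[OF \<pi>N[OF xB[OF that(1)]]] that(2) B_sub unfolding X_def by (metis subsetD)
    moreover have "L (X i q * p) = L (mvar i * q * p)"
      using L_cong[OF \<pi>N[OF xB[OF that(2)]]] that(1) B_sub unfolding X_def by (metis subsetD)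
    ultimately show ?thesis by (simp add: mult_ac)
  qed
  have X_X: "L (X i (X j p) * q) = L (mvar j * p * (mvar i * q))" if "p \<in> ?B" "q \<in> ?B" for i j p q
  proof -
    have "L (X i (X j p) * q) = L (X j p * (mvar i * q))"
      using L_cong[OF \<pi>N[OF xB[OF XB[OF that(1)]]], of q i j] that(2) B_sub
      unfolding X_def by (simp add: mult_ac subset_iff)
    also have "\<dots> = L (mvar j * p * (mvar i * q))"
      using L_cong[OF \<pi>N[OF xB[OF that(1)]] xB[OF that(2)]] unfolding X_def by simp
    finally show ?thesis .
  qed
  \<comment> \<open>The commutator is orthogonal to all normal forms by \<open>X_X\<close>, in particular to itself, hence it
    lies in \<open>N\<close>; being a normal form it is then zero.\<close>
  have X_comm: "X i (X j p) = X j (X i p)" if p: "p \<in> ?B" for i j p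
  proof -
    let ?d = "X i (X j p) - X j (X i p)"
    have dB: "?d \<in> ?B" by (intro polys_le_closed XB p)
    have ortho: "L (q * ?d) = 0" if q: "q \<in> ?B" for q
    proof -
      have "L (X i (X j p) * q) = L (X j (X i p) * q)"
        unfolding X_X[OF p q] by (simp add: mult_ac)
      then show ?thesis by (simp add: right_diff_distrib linear_diff[OF L] mult.commute[of q])
    qed
    have "?d \<in> N"
      using psd_form_null[OF L subspace_polys_le psd, of s ?d] ortho[OF dB] dB B_sub
      unfolding N by auto
    then have "\<pi> ?d = 0" by (rule \<pi>(2))
    moreover have "\<pi> ?d = ?d"
      using \<pi>_idem xB XB p by (simp add: linear_diff[OF \<pi>(1)] X_def)
    ultimately show ?thesis by simp
  qed
  have one_B: "\<pi> 1 \<in> ?B" by (rule \<pi>B) simp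
  have "\<exists>T :: 'n monom \<Rightarrow> _. T 0 = \<pi> 1 \<and> (\<forall>\<alpha>. T \<alpha> \<in> ?B) \<and>
    (\<forall>i \<alpha>. T (Poly_Mapping.single i 1 + \<alpha>) = X i (T \<alpha>))"
    by (rule commuting_operators_monom[where X = X, OF one_B XB X_comm])
  then obtain T :: "'n monom \<Rightarrow> ('n, real) mpoly" where T: "T 0 = \<pi> 1" "\<And>\<alpha>. T \<alpha> \<in> ?B"
    "\<And>i \<alpha>. T (Poly_Mapping.single i 1 + \<alpha>) = X i (T \<alpha>)"
    by blast
  define \<phi> where "\<phi> = lin_ext T"
  have \<phi>_lin: "linear \<phi>" unfolding \<phi>_def by (rule linear_lin_ext)
  have \<phi>_single: "\<phi> (Poly_Mapping.single \<alpha> 1) = T \<alpha>" for \<alpha> by (simp add: \<phi>_def)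
  have \<phi>_B: "\<phi> p \<in> ?B" for p
    unfolding \<phi>_def lin_ext_def by (intro polys_le_closed T)
  have X_lin: "linear (X i)" for i
    unfolding X_def using linear_compose[OF linear_mult_right \<pi>(1), of "mvar i"] by (simp add: o_def)
  have \<phi>_X: "\<phi> (mvar i * p) = X i (\<phi> p)" for i p
  proof -
    have "subspace {p. \<phi> (mvar i * p) = X i (\<phi> p)}"
      by (auto simp: subspace_def distrib_left linear_0[OF \<phi>_lin] linear_0[OF X_lin]
          linear_add[OF \<phi>_lin] linear_add[OF X_lin] linear_scale[OF \<phi>_lin] linear_scale[OF X_lin])
    moreover have "\<phi> (mvar i * Poly_Mapping.single \<alpha> 1) = X i (\<phi> (Poly_Mapping.single \<alpha> 1))" for \<alpha>
      by (simp only: \<phi>_single T(3) flip: single_monom_add)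
    ultimately show ?thesis
      using mpoly_subspace_induct[of "{p. \<phi> (mvar i * p) = X i (\<phi> p)}" p] by simp
  qed
  \<comment> \<open>In degree at most \<open>s\<close> nothing new happens. The induction uses that \<open>x\<^sub>i n\<close> is in \<open>N\<close> for \<open>n\<close> in \<open>N\<close> of
    degree below \<open>s\<close>: it is orthogonal to \<open>q\<close> of degree below \<open>s\<close> since \<open>n\<close> is orthogonal to \<open>x\<^sub>i q\<close>, and
    any \<open>q\<close> of degree \<open>s\<close> may be replaced by its normal form.\<close>
  have \<phi>_\<pi>: "\<phi> p = \<pi> p" if "p \<in> polys_le s" for p
  proof -
    have mono: "T \<alpha> = \<pi> (Poly_Mapping.single \<alpha> 1)" if "mdeg \<alpha> \<le> s" for \<alpha>
      using that
    proof (induction "mdeg \<alpha>" arbitrary: \<alpha> rule: less_induct)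
      case less
      show ?case
      proof (cases "\<alpha> = 0")
        case False
        then obtain i \<beta> where \<alpha>: "\<alpha> = Poly_Mapping.single i 1 + \<beta>"
          by (rule nonzero_monom_split)
        let ?b = "Poly_Mapping.single \<beta> (1::real)"
        have b: "?b \<in> ?B" using less.prems \<alpha> by (simp add: monoms_def)
        have n: "?b - \<pi> ?b \<in> N" using \<pi>N b B_sub by blast
        have pb: "\<pi> ?b \<in> ?B" using \<pi>B b B_sub by blast
        have "mvar i * (?b - \<pi> ?b) \<in> N"
        proof -
          have d: "mvar i * (?b - \<pi> ?b) \<in> polys_le s" by (intro xB polys_le_closed b pb)
          have "L (q * (mvar i * (?b - \<pi> ?b))) = 0" if q: "q \<in> ?B" for q
            using LN(1)[OF n xB[OF q, of i]] by (simp add: mult_ac)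
          moreover have "L (q * (mvar i * (?b - \<pi> ?b))) = L (\<pi> q * (mvar i * (?b - \<pi> ?b)))"
            if q: "q \<in> polys_le s" for q
            by (rule L_cong[OF \<pi>N[OF q] d])
          ultimately have "L (q * (mvar i * (?b - \<pi> ?b))) = 0" if q: "q \<in> polys_le s" for q
            using \<pi>B q by metis
          then show ?thesis using d unfolding N by blast
        qed
        then have "\<pi> (mvar i * ?b) = X i (\<pi> ?b)"
          using \<pi>(2) by (force simp: X_def right_diff_distrib linear_diff[OF \<pi>(1)])
        moreover have "T \<beta> = \<pi> ?b" using less \<alpha> by simp
        ultimately show ?thesis unfolding \<alpha> by (simp only: T(3) single_monom_add)
      qed (simp add: T(1))
    qed
    have "subspace {p. \<phi> p = \<pi> p}"
      by (auto simp: subspace_def linear_0[OF \<phi>_lin] linear_0[OF \<pi>(1)]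
          linear_add[OF \<phi>_lin] linear_add[OF \<pi>(1)] linear_scale[OF \<phi>_lin] linear_scale[OF \<pi>(1)])
    then show ?thesis
      using mpoly_subspace_induct[of "{p. \<phi> p = \<pi> p}" p] that mono
      by (auto simp: polys_le_def monoms_def \<phi>_single)
  qed
  have NJ: "N \<subseteq> gen_ideal N" by (rule gen_ideal_superset)
  note subJ = subspace_gen_ideal[of N]
  have \<phi>_mod: "p - \<phi> p \<in> gen_ideal N" for p
  proof -
    have "Poly_Mapping.single \<alpha> 1 - T \<alpha> \<in> gen_ideal N" for \<alpha>
    proof (induction "mdeg \<alpha>" arbitrary: \<alpha> rule: less_induct)
      case less
      show ?case
      proof (cases "\<alpha> = 0")
        case True
        then show ?thesis using \<pi>N[of 1] NJ by (auto simp: T(1))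
      next
        case False
        then obtain i \<beta> where \<alpha>: "\<alpha> = Poly_Mapping.single i 1 + \<beta>"
          by (rule nonzero_monom_split)
        have "mvar i * (Poly_Mapping.single \<beta> 1 - T \<beta>) \<in> gen_ideal N"
          using less[of \<beta>] \<alpha> by (intro gen_ideal_mult) simp
        moreover have "mvar i * T \<beta> - X i (T \<beta>) \<in> gen_ideal N"
          using \<pi>N[OF xB[OF T(2)]] NJ unfolding X_def by blast
        ultimately have "mvar i * (Poly_Mapping.single \<beta> 1 - T \<beta>) + (mvar i * T \<beta> - X i (T \<beta>)) \<in> gen_ideal N"
          by (rule gen_ideal_add)
        then show ?thesis
          unfolding \<alpha> by (simp only: T(3) single_monom_add right_diff_distrib) simp
      qed
    qed
    moreover have "subspace {p. p - \<phi> p \<in> gen_ideal N}"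
    proof (rule subspaceI)
      fix p q c assume *: "p \<in> {p. p - \<phi> p \<in> gen_ideal N}"
      then show "c *\<^sub>R p \<in> {p. p - \<phi> p \<in> gen_ideal N}"
        using subspace_scale[OF subJ, of "p - \<phi> p" c]
        by (simp add: linear_scale[OF \<phi>_lin] scaleR_diff_right)
      assume "q \<in> {p. p - \<phi> p \<in> gen_ideal N}"
      then show "p + q \<in> {p. p - \<phi> p \<in> gen_ideal N}"
        using subspace_add[OF subJ, of "p - \<phi> p" "q - \<phi> q"] *
        by (simp add: linear_add[OF \<phi>_lin] algebra_simps)
    qed (simp add: linear_0[OF \<phi>_lin] subspace_0[OF subJ])
    ultimately show ?thesis
      using mpoly_subspace_induct[of "{p. p - \<phi> p \<in> gen_ideal N}" p] by (simp add: \<phi>_single)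
  qed
  have ker: "\<phi> p = 0" if "p \<in> gen_ideal N" for p
  proof -
    have sub: "subspace {p. \<phi> p = 0}"
      by (auto simp: subspace_def linear_0[OF \<phi>_lin] linear_add[OF \<phi>_lin] linear_scale[OF \<phi>_lin])
    have "gen_ideal N \<subseteq> {p. \<phi> p = 0}"
    proof (rule gen_ideal_subset)
      show "N \<subseteq> {p. \<phi> p = 0}" using \<phi>_\<pi> \<pi>(2) unfolding N by auto
      show "q * p \<in> {p. \<phi> p = 0}" if "p \<in> {p. \<phi> p = 0}" for p q
        by (rule mult_closed_if_mvar_closed[OF sub _ that]) (simp add: \<phi>_X linear_0[OF X_lin])
    qed (use subspace_0[OF sub] subspace_add[OF sub] in auto)
    then show ?thesis using that by blast
  qed
  \<comment> \<open>The symmetry of the \<open>X i\<close>, extended to all polynomials \<open>p\<close> in them.\<close>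
  have form: "L (\<phi> (p * q) * \<phi> r) = L (\<phi> q * \<phi> (p * r))" for p q r
  proof -
    have "\<forall>q r. L (\<phi> (Poly_Mapping.single \<alpha> 1 * q) * \<phi> r) = L (\<phi> q * \<phi> (Poly_Mapping.single \<alpha> 1 * r))" for \<alpha>
    proof (induction "mdeg \<alpha>" arbitrary: \<alpha> rule: less_induct)
      case less
      show ?case
      proof (cases "\<alpha> = 0")
        case False
        then obtain i \<beta> where \<alpha>: "\<alpha> = Poly_Mapping.single i 1 + \<beta>"
          by (rule nonzero_monom_split)
        have IH: "L (\<phi> (Poly_Mapping.single \<beta> 1 * q) * \<phi> r) = L (\<phi> q * \<phi> (Poly_Mapping.single \<beta> 1 * r))" for q r
          using less[of \<beta>] \<alpha> by simp
        have "L (\<phi> (mvar i * (Poly_Mapping.single \<beta> 1 * q)) * \<phi> r)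
            = L (\<phi> q * \<phi> (mvar i * (Poly_Mapping.single \<beta> 1 * r)))" for q r
        proof -
          have "L (\<phi> (mvar i * (Poly_Mapping.single \<beta> 1 * q)) * \<phi> r)
              = L (\<phi> (Poly_Mapping.single \<beta> 1 * q) * \<phi> (mvar i * r))"
            unfolding \<phi>_X by (rule X_sym[OF \<phi>_B \<phi>_B])
          also have "\<dots> = L (\<phi> q * \<phi> (Poly_Mapping.single \<beta> 1 * (mvar i * r)))" by (rule IH)
          finally show ?thesis by (simp only: mult.left_commute)
        qed
        then show ?thesis unfolding \<alpha> single_monom_add mult.assoc by blast
      qed simp
    qed
    moreover have "subspace {p. L (\<phi> (p * q) * \<phi> r) = L (\<phi> q * \<phi> (p * r))}"
      by (auto simp: subspace_def linear_0[OF \<phi>_lin] linear_add[OF \<phi>_lin] linear_scale[OF \<phi>_lin]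
          linear_0[OF L] linear_add[OF L] linear_scale[OF L] distrib_left distrib_right)
    ultimately show ?thesis
      using mpoly_subspace_induct[of "{p. L (\<phi> (p * q) * \<phi> r) = L (\<phi> q * \<phi> (p * r))}" p] by simp
  qed
  define \<Lambda> where "\<Lambda> p = L (\<phi> p * \<phi> 1)" for p
  have \<Lambda>_mult: "\<Lambda> (p * q) = L (\<phi> q * \<phi> p)" for p q
    unfolding \<Lambda>_def using form[of p q 1] by simp
  have \<Lambda>_lin: "linear \<Lambda>"
    unfolding \<Lambda>_def by (rule linearI)
      (simp_all add: linear_add[OF \<phi>_lin] linear_scale[OF \<phi>_lin] linear_add[OF L] linear_scale[OF L] distrib_right)
  have \<phi>N: "p - \<phi> p \<in> N" if "p \<in> polys_le s" for p
    using \<pi>N \<phi>_\<pi> that by simp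
  have \<phi>s: "\<phi> p \<in> polys_le s" for p using \<phi>_B B_sub by blast
  have \<Lambda>_L_mult: "\<Lambda> (p * q) = L (p * q)" if "p \<in> polys_le s" "q \<in> polys_le s" for p q
  proof -
    have "L (p * q) = L (\<phi> p * q)" by (rule L_cong[OF \<phi>N[OF that(1)] that(2)])
    also have "\<dots> = L (q * \<phi> p)" by (simp add: mult.commute)
    also have "\<dots> = L (\<phi> q * \<phi> p)" by (rule L_cong[OF \<phi>N[OF that(2)] \<phi>s])
    finally show ?thesis by (simp add: \<Lambda>_mult)
  qed
  show ?thesis
  proof (rule that[OF \<Lambda>_lin])
    show "\<Lambda> p = L p" if "p \<in> polys_le (2 * s)" for p
    proof -
      have "\<Lambda> (Poly_Mapping.single \<gamma> 1) = L (Poly_Mapping.single \<gamma> 1)" if "\<gamma> \<in> monoms (2 * s)" for \<gamma>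
      proof -
        have "mdeg \<gamma> \<le> s + s" using that by (simp add: monoms_def mult_2)
        then obtain \<alpha> \<beta> where "\<gamma> = \<alpha> + \<beta>" "mdeg \<alpha> \<le> s" "mdeg \<beta> \<le> s"
          by (rule monom_split_mdeg)
        then show ?thesis
          using \<Lambda>_L_mult[of "Poly_Mapping.single \<alpha> 1" "Poly_Mapping.single \<beta> 1"]
          by (simp add: mult_single monoms_def)
      qed
      moreover have "subspace {p. \<Lambda> p = L p}"
        by (auto simp: subspace_def linear_0[OF \<Lambda>_lin] linear_add[OF \<Lambda>_lin] linear_scale[OF \<Lambda>_lin]
            linear_0[OF L] linear_add[OF L] linear_scale[OF L])
      ultimately show ?thesis
        using mpoly_subspace_induct[of "{p. \<Lambda> p = L p}" p] that by (auto simp: polys_le_def)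
    qed
    show "\<Lambda> p = 0" if "p \<in> gen_ideal N" for p
      by (simp add: \<Lambda>_def ker[OF that] linear_0[OF L])
    show "0 \<le> \<Lambda> (p * p)" for p
      by (simp add: \<Lambda>_mult psd \<phi>s)
    show "\<exists>q\<in>polys_le (s - 1). p - q \<in> gen_ideal N" for p
      using \<phi>_mod \<phi>_B by blast
    show "p \<in> gen_ideal N" if "\<Lambda> (p * p) = 0" for p
    proof -
      have "\<phi> p \<in> N"
        using psd_form_null[OF L subspace_polys_le psd \<phi>s] that \<phi>s
        unfolding N \<Lambda>_mult by blast
      then show ?thesis
        using gen_ideal_add[OF \<phi>_mod[of p], of "\<phi> p"] NJ by auto
    qed
  qed
qed

section \<open>Real radical ideals of finite codimension\<close>

text \<open>Substitution into a univariate polynomial. The analogue of \<^const>\<open>poly\<close>, which would require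
  the coefficients to be multivariate polynomials too.\<close>

definition poly_subst :: "('n, real) mpoly \<Rightarrow> real poly \<Rightarrow> ('n, real) mpoly"
  where "poly_subst u f = fold_coeffs (\<lambda>a r. a *\<^sub>R 1 + u * r) f 0"

lemma poly_subst_0 [simp]: "poly_subst u 0 = 0"
  by (simp add: poly_subst_def)

lemma poly_subst_pCons [simp]: "poly_subst u (pCons a f) = a *\<^sub>R 1 + u * poly_subst u f"
  by (cases "f = 0 \<and> a = 0") (auto simp: poly_subst_def)

lemma poly_subst_add [simp]: "poly_subst u (f + g) = poly_subst u f + poly_subst u g"
  by (induction f g rule: poly_induct2) (simp_all add: scaleR_add_left distrib_left)

lemma poly_subst_smult [simp]: "poly_subst u (smult c f) = c *\<^sub>R poly_subst u f"
  by (induction f) (simp_all add: scaleR_add_right)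

lemma poly_subst_mult [simp]: "poly_subst u (f * g) = poly_subst u f * poly_subst u g"
  by (induction f) (simp_all add: distrib_right mult.assoc)

lemma poly_subst_monom [simp]: "poly_subst u (monom c k) = c *\<^sub>R u ^ k"
  by (induction k) (simp_all add: monom_0 monom_Suc)

lemma poly_subst_sum [simp]: "poly_subst u (sum f A) = (\<Sum>a\<in>A. poly_subst u (f a))"
  by (induction A rule: infinite_finite_induct) simp_all

lemma eval_poly_subst:
  fixes z :: "complex ^ 'n::finite"
  shows "eval_mpoly (poly_subst (mvar i) f) z = poly (map_poly complex_of_real f) (z $ i)"
  by (induction f) (simp_all add: map_poly_pCons scaleR_conv_of_real)

text \<open>By the fundamental theorem of algebra there is a complex root; if it is not real, the remainder
  modulo its real quadratic polynomial is a real linear polynomial with a nonreal root, hence zero.\<close>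

lemma real_poly_linear_or_quadratic_factor:
  fixes f :: "real poly"
  assumes "degree f > 0"
  obtains a g where "f = [:-a, 1:] * g"
    | a b g where "b \<noteq> 0" "f = [:a\<^sup>2 + b\<^sup>2, -2 * a, 1:] * g"
proof -
  have "degree (map_poly complex_of_real f) = degree f"
    by (simp add: degree_map_poly)
  then have "\<not> constant (poly (map_poly complex_of_real f))"
    using assms by (simp add: constant_degree)
  then obtain z where z: "poly (map_poly complex_of_real f) z = 0"
    using fundamental_theorem_of_algebra by blast
  show ?thesis
  proof (cases "Im z = 0")
    case True
    then have "z = complex_of_real (Re z)" by (simp add: complex_eq_iff)
    moreover have "poly (map_poly complex_of_real f) (of_real x) = of_real (poly f x)" for x
      by (induction f) (simp_all add: map_poly_pCons)
    ultimately have "poly f (Re z) = 0"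
      using z by (metis of_real_eq_0_iff)
    then show ?thesis using that(1) by (auto simp: poly_eq_0_iff_dvd elim: dvdE)
  next
    case False
    define q where "q = [:(Re z)\<^sup>2 + (Im z)\<^sup>2, -2 * Re z, 1:]"
    \<comment> \<open>The value of a real polynomial at \<open>z\<close>, as a composition of two ring homomorphisms.\<close>
    define E where "E p = eval_mpoly (poly_subst (mvar ()) p) (\<chi> _. z)" for p
    have E_mult: "E (p * r) = E p * E r" and E_add: "E (p + r) = E p + E r" for p r
      by (simp_all add: E_def)
    have "E q = 0"
      by (simp add: E_def q_def complex_eq_iff scaleR_conv_of_real power2_eq_square algebra_simps)
    moreover have "E f = 0" using z by (simp add: E_def eval_poly_subst)
    ultimately have E_mod: "E (f mod q) = 0"
      using E_add[of "f div q * q" "f mod q"] by (simp add: E_mult)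
    have "degree (f mod q) < 2"
      using degree_mod_less'[of q f] by (cases "f mod q = 0") (auto simp: q_def)
    then have fmod: "f mod q = [:coeff (f mod q) 0, coeff (f mod q) 1:]"
      by (intro poly_eqI) (auto simp: coeff_pCons coeff_eq_0 split: nat.splits)
    obtain c d where cd: "f mod q = [:c, d:]" using fmod by blast
    have "c + d * Re z = 0" "d * Im z = 0"
      using E_mod unfolding cd by (simp_all add: E_def complex_eq_iff)
    then have "f mod q = 0" using cd False by simp
    then have "f = q * (f div q)" by (metis add.right_neutral mult_div_mod_eq)
    then show ?thesis using that(2)[OF False] unfolding q_def by blast
  qed
qed

text \<open>The ideals to which the positive functional leads. Real ideals have the last property for sums
  of arbitrarily many squares; two are enough to exclude repeated and nonreal roots of the univariate
  polynomials in the ideal.\<close>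

definition two_square_ideal :: "('n, real) mpoly set \<Rightarrow> bool"
  where "two_square_ideal K \<longleftrightarrow> subspace K \<and> (\<forall>p\<in>K. \<forall>q. q * p \<in> K) \<and>
    (\<forall>p r. p * p + r * r \<in> K \<longrightarrow> r \<in> K)"

lemma two_square_idealD:
  assumes "two_square_ideal K"
  shows "subspace K" "p \<in> K \<Longrightarrow> q * p \<in> K" "p * p + r * r \<in> K \<Longrightarrow> r \<in> K"
  using assms unfolding two_square_ideal_def by blast+

text \<open>Read modulo \<open>K\<close>: the class of \<open>q\<close> is annihilated by \<open>f(u)\<close>, and some nonzero multiple of it is
  an eigenvector of multiplication by \<open>u\<close>. Linear factors of \<open>f\<close> are tried one after the other. A
  quadratic factor \<open>(u - a)\<^sup>2 + b\<^sup>2\<close> can be dropped: if it annihilates \<open>w\<close>, then the sum of the squares of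
  \<open>(u - a) w\<close> and \<open>b w\<close> is in \<open>K\<close>, hence so is \<open>w\<close>.\<close>

lemma eigenvector_step:
  fixes K :: "('n::finite, real) mpoly set" and f :: "real poly"
  assumes K: "two_square_ideal K"
  shows "f \<noteq> 0 \<Longrightarrow> poly_subst u f * q \<in> K \<Longrightarrow> q \<notin> K
    \<Longrightarrow> \<exists>a v. v * q \<notin> K \<and> (u - a *\<^sub>R 1) * (v * q) \<in> K"
proof (induction "degree f" arbitrary: f q rule: less_induct)
  case less
  note sub = two_square_idealD(1)[OF K] and mult = two_square_idealD(2)[OF K]
    and real = two_square_idealD(3)[OF K]
  show ?case
  proof (cases "degree f = 0")
    case True
    then obtain c where c: "f = [:c:]" by (rule degree_eq_zeroE)
    then have cq: "c *\<^sub>R q \<in> K" and "c \<noteq> 0" using less.prems by simp_all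
    have "inverse c *\<^sub>R (c *\<^sub>R q) \<in> K" by (rule subspace_scale[OF sub cq])
    then show ?thesis using \<open>c \<noteq> 0\<close> less.prems(3) by simp
  next
    case False
    then have "degree f > 0" by simp
    then show ?thesis
    proof (cases rule: real_poly_linear_or_quadratic_factor)
      case (1 a g)
      have g: "g \<noteq> 0" using 1 less.prems(1) by auto
      then have deg: "degree g < degree f" by (simp add: 1 degree_mult_eq del: mult_pCons_left)
      show ?thesis
      proof (cases "(u - a *\<^sub>R 1) * q \<in> K")
        case True
        then show ?thesis using less.prems(3) by (metis mult_1)
      next
        case False
        have "poly_subst u g * ((u - a *\<^sub>R 1) * q) \<in> K"
          using less.prems(2) unfolding 1(1) poly_subst_mult by (simp add: mult_ac)
        from less.hyps[OF deg g this False] obtain c v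
          where "v * (u - a *\<^sub>R 1) * q \<notin> K \<and> (u - c *\<^sub>R 1) * (v * (u - a *\<^sub>R 1) * q) \<in> K"
          unfolding mult.assoc by blast
        then show ?thesis by blast
      qed
    next
      case (2 a b g)
      have g: "g \<noteq> 0" using 2 less.prems(1) by auto
      then have deg: "degree g < degree f" by (simp add: 2 degree_mult_eq del: mult_pCons_left)
      define w where "w = poly_subst u g * q"
      have "(-2 * a) *\<^sub>R (1 :: ('n, real) mpoly) = - (a *\<^sub>R 1 + a *\<^sub>R 1)"
        by (simp only: scaleR_add_left[symmetric] scaleR_minus_left[symmetric]) simp
      then have "poly_subst u [:a\<^sup>2 + b\<^sup>2, -2 * a, 1:] =
          (u - a *\<^sub>R 1) * (u - a *\<^sub>R 1) + (b *\<^sub>R 1) * (b *\<^sub>R 1)"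
        unfolding poly_subst_pCons by (simp add: algebra_simps power2_eq_square)
      then have "poly_subst u f * q = ((u - a *\<^sub>R 1) * (u - a *\<^sub>R 1) + (b *\<^sub>R 1) * (b *\<^sub>R 1)) * w"
        unfolding 2(2) poly_subst_mult w_def by (simp only: mult.assoc)
      then have "w * (((u - a *\<^sub>R 1) * (u - a *\<^sub>R 1) + (b *\<^sub>R 1) * (b *\<^sub>R 1)) * w) \<in> K"
        using mult[OF less.prems(2), of w] by simp
      also have "w * (((u - a *\<^sub>R 1) * (u - a *\<^sub>R 1) + (b *\<^sub>R 1) * (b *\<^sub>R 1)) * w)
        = ((u - a *\<^sub>R 1) * w) * ((u - a *\<^sub>R 1) * w) + ((b *\<^sub>R 1) * w) * ((b *\<^sub>R 1) * w)"
        by (simp only: distrib_left distrib_right mult_ac)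
      finally have "(b *\<^sub>R 1) * w \<in> K" by (rule real)
      then have "inverse b *\<^sub>R ((b *\<^sub>R 1) * w) \<in> K" by (rule subspace_scale[OF sub])
      then have "w \<in> K" using 2(1) by simp
      then show ?thesis using less.hyps[OF deg g _ less.prems(3)] unfolding w_def by blast
    qed
  qed
qed

text \<open>Eigenvectors of one multiplication after the other give a joint eigenvector \<open>q = v * p\<close>, as passing
  to multiples preserves the eigenvector equations already achieved. Any polynomial \<open>g\<close> acts on \<open>q\<close> as
  the scalar \<open>g(x)\<close>, where \<open>x\<close> collects the eigenvalues: for \<open>g\<close> in \<open>K\<close> this scalar is zero, and for
  \<open>g = p\<close> it is not, since otherwise \<open>q\<^sup>2 = v p q\<close> would be in \<open>K\<close>.\<close>

lemma real_zero_avoiding: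
  fixes K :: "('n::finite, real) mpoly set"
  assumes K: "two_square_ideal K"
    and alg: "\<And>i. \<exists>f. f \<noteq> 0 \<and> poly_subst (mvar i) f \<in> K"
    and p: "p \<notin> K"
  shows "\<exists>x \<in> real_variety K. eval_mpoly p x \<noteq> 0"
proof -
  note sub = two_square_idealD(1)[OF K] and mult = two_square_idealD(2)[OF K]
    and real = two_square_idealD(3)[OF K]
  have "\<exists>v (c :: 'n \<Rightarrow> real). v * p \<notin> K \<and> (\<forall>i\<in>A. (mvar i - c i *\<^sub>R 1) * (v * p) \<in> K)" for A
  proof (induction A rule: infinite_finite_induct)
    case empty
    then show ?case using p by (intro exI[of _ 1]) simp
  next
    case (insert i A)
    then obtain v c where v: "v * p \<notin> K" "\<forall>i\<in>A. (mvar i - c i *\<^sub>R 1) * (v * p) \<in> K"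
      by blast
    obtain f where "f \<noteq> 0" "poly_subst (mvar i) f \<in> K" using alg by blast
    then have "poly_subst (mvar i) f * (v * p) \<in> K"
      using mult[of "poly_subst (mvar i) f" "v * p"] by (simp add: mult.commute)
    from eigenvector_step[OF K \<open>f \<noteq> 0\<close> this v(1)]
    obtain a w where w: "w * (v * p) \<notin> K" "(mvar i - a *\<^sub>R 1) * (w * (v * p)) \<in> K"
      by blast
    have "(mvar j - c j *\<^sub>R 1) * (w * (v * p)) \<in> K" if "j \<in> A" for j
      using mult[of "(mvar j - c j *\<^sub>R 1) * (v * p)" w] v(2) that by (simp only: mult.left_commute)
    then show ?case
      using w insert.hyps
      by (intro exI[of _ "w * v"] exI[of _ "c(i := a)"]) (auto simp: mult.assoc)
  qed simp
  then obtain v c where v: "v * p \<notin> K" "\<And>i. (mvar i - c i *\<^sub>R 1) * (v * p) \<in> K"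
    by (metis UNIV_I)
  define q where "q = v * p"
  define x :: "real ^ 'n" where "x = (\<chi> i. c i)"
  note q = v[folded q_def]
  have eig: "g * q - eval_mpoly g x *\<^sub>R q \<in> K" for g
  proof -
    let ?G = "{g. g * q - eval_mpoly g x *\<^sub>R q \<in> K}"
    have "subspace ?G"
    proof (rule subspaceI)
      fix g g' r assume *: "g \<in> ?G"
      then show "r *\<^sub>R g \<in> ?G"
        using subspace_scale[OF sub, of "g * q - eval_mpoly g x *\<^sub>R q" r]
        by (simp add: scaleR_diff_right)
      assume "g' \<in> ?G"
      then show "g + g' \<in> ?G"
        using subspace_add[OF sub, of "g * q - eval_mpoly g x *\<^sub>R q" "g' * q - eval_mpoly g' x *\<^sub>R q"] *
        by (simp add: distrib_right scaleR_add_left algebra_simps)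
    qed (simp add: subspace_0[OF sub])
    moreover have "mvar i * g \<in> ?G" if g: "g \<in> ?G" for i g
    proof -
      have "mvar i * (g * q - eval_mpoly g x *\<^sub>R q) + eval_mpoly g x *\<^sub>R ((mvar i - c i *\<^sub>R 1) * q) \<in> K"
        using g mult q(2) by (intro subspace_add[OF sub] subspace_scale[OF sub]) auto
      also have "mvar i * (g * q - eval_mpoly g x *\<^sub>R q) + eval_mpoly g x *\<^sub>R ((mvar i - c i *\<^sub>R 1) * q)
        = (mvar i * g) * q - eval_mpoly (mvar i * g) x *\<^sub>R q"
        by (simp add: x_def algebra_simps)
      finally show ?thesis by simp
    qed
    moreover have "1 \<in> ?G" by (simp add: subspace_0[OF sub])
    ultimately have "g * 1 \<in> ?G" by (rule mult_closed_if_mvar_closed)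
    then show ?thesis by simp
  qed
  have "eval_mpoly g x = 0" if "g \<in> K" for g
  proof (rule ccontr)
    assume ne: "eval_mpoly g x \<noteq> 0"
    have "g * q - (g * q - eval_mpoly g x *\<^sub>R q) \<in> K"
      using mult[OF that, of q] by (intro subspace_diff[OF sub] eig) (simp add: mult.commute)
    then have "eval_mpoly g x *\<^sub>R q \<in> K" by simp
    then have "inverse (eval_mpoly g x) *\<^sub>R (eval_mpoly g x *\<^sub>R q) \<in> K"
      by (rule subspace_scale[OF sub])
    then show False using ne q(1) by simp
  qed
  moreover have "eval_mpoly p x \<noteq> 0"
  proof
    assume "eval_mpoly p x = 0"
    then have "p * q \<in> K" using eig[of p] by simp
    then have "0 * 0 + q * q \<in> K" using mult[of "p * q" v] by (simp add: q_def mult_ac)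
    then show False using real q(1) by blast
  qed
  ultimately show ?thesis by (auto simp: real_variety_iff)
qed

text \<open>Representatives of too many powers of \<open>u\<close> in the span of a finite set are linearly dependent.\<close>

lemma algebraic_if_finite_codim:
  fixes K :: "('n::finite, real) mpoly set"
  assumes sub: "subspace K" and codim: "\<And>p. \<exists>q\<in>F. p - q \<in> K" and fin: "F \<subseteq> span D" "finite D"
  shows "\<exists>f. f \<noteq> 0 \<and> poly_subst u f \<in> K"
proof (rule ccontr)
  assume no: "\<not> ?thesis"
  obtain q where q: "\<And>k::nat. q k \<in> F" "\<And>k. u ^ k - q k \<in> K"
    using codim[of "u ^ _"] by metis
  have dep: "c k = 0" if c: "(\<Sum>k\<in>A. c k *\<^sub>R q k) = 0" "finite A" "k \<in> A" for c A k
  proof -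
    have "(\<Sum>k\<in>A. c k *\<^sub>R (u ^ k - q k)) \<in> K"
      by (intro subspace_sum[OF sub] subspace_scale[OF sub] q)
    then have "poly_subst u (\<Sum>k\<in>A. monom (c k) k) \<in> K"
      using c(1) by (simp add: scaleR_diff_right sum_subtractf)
    then have "(\<Sum>k\<in>A. monom (c k) k) = 0" using no by blast
    then have "coeff (\<Sum>k\<in>A. monom (c k) k) k = 0" by simp
    then show ?thesis using c(2,3) by (simp add: coeff_sum)
  qed
  have inj: "inj q"
  proof (rule injI, rule ccontr)
    fix k l assume kl: "q k = q l" "k \<noteq> l"
    then show False
      using dep[where A = "{k, l}" and c = "\<lambda>j. if j = k then 1 else -1" and k = k] by simp
  qed
  have "independent (q ` {..card D})"
  proof (rule independent_if_scalars_zero)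
    fix c v assume "(\<Sum>v\<in>q ` {..card D}. c v *\<^sub>R v) = 0" "v \<in> q ` {..card D}"
    then show "c v = 0"
      using dep[where A = "{..card D}" and c = "\<lambda>k. c (q k)"] inj
      by (auto simp: sum.reindex inj_on_def)
  qed simp
  then have "card (q ` {..card D}) \<le> card D"
    using independent_span_bound[OF fin(2)] q(1) fin(1) by blast
  then show False
    using inj by (simp add: card_image inj_on_def)
qed

lemma finite_complex_variety:
  fixes K :: "('n::finite, real) mpoly set"
  assumes alg: "\<And>i. \<exists>f. f \<noteq> 0 \<and> poly_subst (mvar i) f \<in> K"
  shows "finite (complex_variety K)"
proof -
  obtain f where f: "\<And>i. f i \<noteq> 0" "\<And>i. poly_subst (mvar i) (f i) \<in> K"
    using alg by metis
  define R where "R i = {z. poly (map_poly complex_of_real (f i)) z = 0}" for i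
  have "map_poly complex_of_real (f i) \<noteq> 0" for i
    using f(1) by (simp add: map_poly_eq_0_iff)
  then have "finite (PiE UNIV R)"
    unfolding R_def by (intro finite_PiE poly_roots_finite) auto
  moreover have "vec_nth ` complex_variety K \<subseteq> PiE UNIV R"
    using f(2) by (auto simp: complex_variety_def R_def simp flip: eval_poly_subst)
  ultimately have "finite (vec_nth ` complex_variety K)" by (rule finite_subset[rotated])
  then show ?thesis by (rule finite_imageD) (auto intro!: inj_onI simp: vec_eq_iff)
qed

text \<open>That \<open>K\<close> is the vanishing ideal of its real zeros is \<open>real_zero_avoiding\<close>. Complex zeros are
  then real: for every coordinate \<open>i\<close> the product of the \<open>x\<^sub>i - w\<^sub>i\<close> over the finitely many real zeros \<open>w\<close>
  is in \<open>K\<close>.\<close>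

lemma real_radical_finite_codim:
  fixes K :: "('n::finite, real) mpoly set"
  assumes K: "two_square_ideal K"
    and codim: "\<And>p. \<exists>q\<in>F. p - q \<in> K" and fin: "F \<subseteq> span D" "finite D"
  shows "finite (real_variety K)" "K = vanishing_ideal (real_variety K)"
    "complex_variety K = complex_point ` real_variety K"
proof -
  let ?W = "real_variety K"
  note alg = algebraic_if_finite_codim[OF two_square_idealD(1)[OF K] codim fin]
  have "complex_point ` ?W \<subseteq> complex_variety K" by (auto simp: real_variety_def)
  then have "finite (complex_point ` ?W)"
    using finite_complex_variety[OF alg] by (rule finite_subset)
  then show W: "finite ?W" by (rule finite_imageD) (auto intro: inj_onI)
  show K: "K = vanishing_ideal ?W"
    using real_zero_avoiding[OF K alg]
    by (auto simp: vanishing_ideal_def real_variety_iff)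
  show "complex_variety K = complex_point ` ?W"
  proof
    show "complex_variety K \<subseteq> complex_point ` ?W"
    proof
      fix z assume z: "z \<in> complex_variety K"
      have real_coord: "\<exists>c. z $ i = complex_of_real c" for i
      proof -
        have "(\<Prod>w\<in>?W. mvar i - (w $ i) *\<^sub>R 1) \<in> vanishing_ideal ?W"
          using W by (auto simp: vanishing_ideal_def)
        then have "eval_mpoly (\<Prod>w\<in>?W. mvar i - (w $ i) *\<^sub>R 1) z = 0"
          using z K unfolding complex_variety_def by blast
        then obtain w where "w \<in> ?W" "z $ i - (w $ i) *\<^sub>R 1 = 0" using W by auto
        then show ?thesis by (auto simp: scaleR_conv_of_real)
      qed
      then have "z = complex_point (\<chi> i. Re (z $ i))"
        by (simp add: complex_point_def vec_eq_iff) (metis Re_complex_of_real)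
      then show "z \<in> complex_point ` ?W"
        using z unfolding real_variety_def by (metis (mono_tags, lifting) CollectI imageI)
    qed
  qed fact
qed

lemma interpolation:
  fixes W :: "(real ^ 'n::finite) set"
  assumes "finite W"
  obtains e :: "real ^ 'n \<Rightarrow> ('n, real) mpoly"
    where "\<And>w w'. w \<in> W \<Longrightarrow> w' \<in> W \<Longrightarrow> eval_mpoly (e w) w' = (if w' = w then 1 else 0)"
proof -
  have "\<exists>l :: ('n, real) mpoly. eval_mpoly l w = 1 \<and> eval_mpoly l w' = 0"
    if ne: "w \<noteq> w'" for w w' :: "real ^ 'n"
  proof -
    obtain i where "w $ i \<noteq> w' $ i" using ne by (auto simp: vec_eq_iff)
    then show ?thesis
      by (intro exI[of _ "inverse (w $ i - w' $ i) *\<^sub>R (mvar i - (w' $ i) *\<^sub>R 1)"]) simp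
  qed
  then obtain l :: "real ^ 'n \<Rightarrow> real ^ 'n \<Rightarrow> ('n, real) mpoly"
    where l: "\<And>w w'. w \<noteq> w' \<Longrightarrow> eval_mpoly (l w w') w = 1 \<and> eval_mpoly (l w w') w' = 0"
    by metis
  have "eval_mpoly (\<Prod>u\<in>W - {w}. l w u) w' = (if w' = w then 1 else 0)" if "w \<in> W" "w' \<in> W" for w w'
  proof (cases "w' = w")
    case True
    have "eval_mpoly (l w u) w = 1" if "u \<in> W - {w}" for u
      using l[of w u] that by auto
    then show ?thesis using True by (simp add: prod.neutral)
  next
    case False
    then show ?thesis using assms that l[of w w'] by (auto intro!: prod_zero bexI[of _ w'])
  qed
  then show ?thesis by (rule that)
qed

section \<open>Flat truncated moment sequences\<close>

text \<open>The column space is the space of polynomials of degree at most \<open>s\<close> modulo those vanishing on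
  \<open>W\<close>, so the images of the interpolation polynomials are a basis of it.\<close>

lemma moment_rank_eq_card:
  fixes W :: "(real ^ 'n::finite) set"
  assumes W: "finite W" and ker: "moment_kernel s y = polys_le s \<inter> vanishing_ideal W"
    and e: "\<And>w. w \<in> W \<Longrightarrow> e w \<in> polys_le s"
    "\<And>w w'. w \<in> W \<Longrightarrow> w' \<in> W \<Longrightarrow> eval_mpoly (e w) w' = (if w' = w then 1 else 0)"
  shows "moment_rank s y = card W"
proof -
  let ?f = "moment_map s y" and ?g = "\<lambda>w. moment_map s y (e w)"
  have null: "?f p = 0 \<longleftrightarrow> (\<forall>w\<in>W. eval_mpoly p w = 0)" if "p \<in> polys_le s" for p
    using that by (simp add: moment_map_eq_0_iff ker vanishing_ideal_def)
  have comb: "(\<Sum>w\<in>W. c w *\<^sub>R e w) \<in> polys_le s" for c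
    by (intro polys_le_closed e)
  have eval_comb: "eval_mpoly (\<Sum>w\<in>W. c w *\<^sub>R e w) w' = c w'" if "w' \<in> W" for c w'
    using W e(2) that by (simp add: if_distrib[of "\<lambda>x. _ * x"] cong: sum.cong if_cong)
  have dep: "c w = 0" if "(\<Sum>w\<in>W. c w *\<^sub>R ?g w) = 0" "w \<in> W" for c w
  proof -
    have "?f (\<Sum>w\<in>W. c w *\<^sub>R e w) = 0" using that(1) by simp
    then have "eval_mpoly (\<Sum>w\<in>W. c w *\<^sub>R e w) w = 0" using null[OF comb] that(2) by blast
    then show ?thesis by (simp only: eval_comb[OF that(2)])
  qed
  have inj: "inj_on ?g W"
  proof (rule inj_onI)
    fix w w' assume w: "w \<in> W" "w' \<in> W" "?g w = ?g w'"
    then have "e w - e w' \<in> polys_le s" by (intro polys_le_closed e)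
    then have "eval_mpoly (e w - e w') w = 0" using null[of "e w - e w'"] w by simp
    then show "w = w'" using e(2) w by (simp split: if_splits)
  qed
  have "independent (?g ` W)"
  proof (rule independent_if_scalars_zero)
    fix c v assume "(\<Sum>v\<in>?g ` W. c v *\<^sub>R v) = 0" "v \<in> ?g ` W"
    then show "c v = 0"
      using dep[of "\<lambda>w. c (?g w)"] inj by (auto simp: sum.reindex)
  qed (use W in simp)
  moreover have "?f ` polys_le s \<subseteq> span (?g ` W)"
  proof clarify
    fix p :: "('n, real) mpoly" assume p: "p \<in> polys_le s"
    let ?c = "\<Sum>w\<in>W. eval_mpoly p w *\<^sub>R e w"
    have "?f (p - ?c) = 0"
      using null[OF polys_le_closed(2)[OF p comb]] eval_comb by simp
    then have "?f p = (\<Sum>w\<in>W. eval_mpoly p w *\<^sub>R ?g w)" by simp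
    then show "?f p \<in> span (?g ` W)"
      by (auto intro: span_sum span_scale span_base)
  qed
  moreover have "?g ` W \<subseteq> ?f ` polys_le s" using e(1) by blast
  ultimately have "card (?g ` W) = dim (?f ` polys_le s)"
    by (intro basis_card_eq_dim)
  then show ?thesis using inj by (simp add: moment_rank_eq_dim card_image)
qed

text \<open>Everything that flatness at one order \<open>s\<close> says about the ideal; both parts of the theorem start
  from here. The functional \<open>\<Lambda>\<close> is needed again in part (ii), to read off the signs of the constraints on
  \<open>W\<close>.\<close>

lemma flat_moment_kernel:
  fixes y :: "'n::finite monom \<Rightarrow> real"
  assumes psd: "\<And>q. q \<in> polys_le s \<Longrightarrow> 0 \<le> lin_ext y (q * q)"
    and s: "1 \<le> s" and flat: "\<And>p. p \<in> polys_le s \<Longrightarrow> \<exists>q\<in>polys_le (s - 1). p - q \<in> moment_kernel s y"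
  defines "J \<equiv> gen_ideal (moment_kernel s y)"
  obtains \<Lambda> W where "finite W" "card W = moment_rank s y" "J = vanishing_ideal W"
    "complex_variety J = complex_point ` W"
    "linear \<Lambda>" "\<And>p. p \<in> polys_le (2 * s) \<Longrightarrow> \<Lambda> p = lin_ext y p" "\<And>p. p \<in> J \<Longrightarrow> \<Lambda> p = 0"
    "\<And>p. 0 \<le> \<Lambda> (p * p)" "\<And>p. \<Lambda> (p * p) = 0 \<Longrightarrow> p \<in> J"
    "\<And>p. \<exists>q\<in>polys_le (s - 1). p - q \<in> J"
proof -
  have N: "moment_kernel s y = {p \<in> polys_le s. \<forall>q\<in>polys_le s. lin_ext y (q * p) = 0}"
    by (auto simp: moment_kernel_iff)
  obtain \<Lambda> where \<Lambda>: "linear \<Lambda>" "\<And>p. p \<in> polys_le (2 * s) \<Longrightarrow> \<Lambda> p = lin_ext y p"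
    "\<And>p. p \<in> J \<Longrightarrow> \<Lambda> p = 0" "\<And>p. 0 \<le> \<Lambda> (p * p)"
    "\<And>p. \<Lambda> (p * p) = 0 \<Longrightarrow> p \<in> J" "\<And>p. \<exists>q\<in>polys_le (s - 1). p - q \<in> J"
    using flat_extension[OF linear_lin_ext s psd N flat] unfolding J_def by blast
  have real: "r \<in> J" if "p * p + r * r \<in> J" for p r
  proof -
    have "\<Lambda> (p * p) + \<Lambda> (r * r) = 0" using \<Lambda>(3)[OF that] by (simp add: linear_add[OF \<Lambda>(1)])
    then have "\<Lambda> (r * r) = 0" using \<Lambda>(4)[of p] \<Lambda>(4)[of r] by linarith
    then show ?thesis by (rule \<Lambda>(5))
  qed
  have mult: "q * p \<in> J" if "p \<in> J" for p q
    using that unfolding J_def by (rule gen_ideal_mult)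
  have J: "two_square_ideal J"
    using subspace_gen_ideal[of "moment_kernel s y"] mult real
    unfolding two_square_ideal_def J_def by blast
  have fin: "polys_le (s - 1) \<subseteq> span ((\<lambda>a. Poly_Mapping.single a (1::real)) ` (monoms (s - 1) :: 'n monom set))"
    "finite ((\<lambda>a. Poly_Mapping.single a (1::real)) ` (monoms (s - 1) :: 'n monom set))"
    by (simp_all add: polys_le_eq_span)
  define W where "W = real_variety J"
  note W = real_radical_finite_codim[OF J \<Lambda>(6) fin, folded W_def]
  obtain e0 :: "real ^ 'n \<Rightarrow> ('n, real) mpoly"
    where e0: "\<And>w w'. w \<in> W \<Longrightarrow> w' \<in> W \<Longrightarrow> eval_mpoly (e0 w) w' = (if w' = w then 1 else 0)"
    using interpolation[OF W(1)] by blast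
  have "\<forall>w. \<exists>q. q \<in> polys_le (s - 1) \<and> e0 w - q \<in> J" using \<Lambda>(6) by blast
  then obtain e where e: "\<forall>w. e w \<in> polys_le (s - 1) \<and> e0 w - e w \<in> J"
    by (elim choice[THEN exE])
  have "eval_mpoly (e w) w' = (if w' = w then 1 else 0)" if "w \<in> W" "w' \<in> W" for w w'
  proof -
    have "eval_mpoly (e0 w - e w) w' = 0"
      using e that(2) unfolding W(2) vanishing_ideal_def by blast
    then show ?thesis using e0[OF that] by simp
  qed
  moreover have "e w \<in> polys_le s" for w using e polys_le_mono[of "s - 1" s] by auto
  moreover have "moment_kernel s y = polys_le s \<inter> J"
  proof
    show "moment_kernel s y \<subseteq> polys_le s \<inter> J"
      using gen_ideal_superset[of "moment_kernel s y"] by (auto simp: J_def moment_kernel_iff)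
    show "polys_le s \<inter> J \<subseteq> moment_kernel s y"
    proof
      fix p assume p: "p \<in> polys_le s \<inter> J"
      have "lin_ext y (q * p) = 0" if "q \<in> polys_le s" for q
        using \<Lambda>(2)[of "q * p"] \<Lambda>(3)[OF mult, of p q] polys_le_mult[OF that, of p s] p
        by (simp add: mult_2)
      then show "p \<in> moment_kernel s y" using p by (simp add: moment_kernel_iff)
    qed
  qed
  ultimately have "moment_rank s y = card W"
    using W(2) by (intro moment_rank_eq_card[OF W(1), of s y e]) auto
  then show ?thesis using that[OF W(1) _ W(2,3) \<Lambda>] by simp
qed

section \<open>The feasible set and the optimal moment sequence\<close>

lemma real_variety_gen_ideal_iff:
  "x \<in> real_variety (gen_ideal A) \<longleftrightarrow> (\<forall>p\<in>A. eval_mpoly p x = 0)"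
  using gen_ideal_superset[of A] gen_ideal_subset_vanishing_ideal[of A "{x}"]
  by (auto simp: real_variety_iff vanishing_ideal_def)

text \<open>Suppose that \<open>p\<close> has two different exponents \<open>\<alpha>\<close> and \<open>\<beta>\<close>, say with \<open>\<alpha>\<^sub>i \<noteq> \<beta>\<^sub>i\<close>. Doubling the
  variable \<open>x\<^sub>i\<close> and subtracting \<open>2\<close> to the power \<open>\<alpha>\<^sub>i\<close> times \<open>p\<close> removes the exponent \<open>\<alpha>\<close>, keeps \<open>\<beta>\<close>,
  and yields again a polynomial that vanishes everywhere. By induction on the number of exponents only a
  single term is left, and that is nonzero at the point with all coordinates 1.\<close>

lemma vanishes_everywhere_imp_0:
  fixes p :: "('n::finite, real) mpoly"
  assumes "\<And>x :: real ^ 'n. eval_mpoly p x = 0"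
  shows "p = 0"
  using assms
proof (induction "card (Poly_Mapping.keys p)" arbitrary: p rule: less_induct)
  case less
  show ?case
  proof (rule ccontr)
    assume "p \<noteq> 0"
    then obtain \<alpha> where \<alpha>: "Poly_Mapping.lookup p \<alpha> \<noteq> 0"
      by (metis poly_mapping_eqI lookup_zero)
    have "Poly_Mapping.lookup p \<beta> = 0" if ne: "\<beta> \<noteq> \<alpha>" for \<beta>
    proof -
      obtain i where i: "Poly_Mapping.lookup \<beta> i \<noteq> Poly_Mapping.lookup \<alpha> i"
        using ne by (metis poly_mapping_eqI)
      define f :: "'n monom \<Rightarrow> real"
        where "f \<gamma> = 2 ^ Poly_Mapping.lookup \<gamma> i - 2 ^ Poly_Mapping.lookup \<alpha> i" for \<gamma>
      define q where "q = lin_ext (\<lambda>\<gamma>. Poly_Mapping.single \<gamma> (f \<gamma>)) p"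
      have q: "Poly_Mapping.lookup q \<gamma> = f \<gamma> * Poly_Mapping.lookup p \<gamma>" for \<gamma>
        by (simp add: q_def lin_ext_def lookup_sum lookup_single when_def in_keys_iff)
      have "eval_mpoly q x = 0" for x :: "real ^ 'n"
      proof -
        define x' where "x' = (\<chi> j. if j = i then 2 * x $ j else x $ j)"
        have "(\<Prod>j\<in>UNIV. (x' $ j) ^ Poly_Mapping.lookup \<gamma> j)
            = 2 ^ Poly_Mapping.lookup \<gamma> i * (\<Prod>j\<in>UNIV. (x $ j) ^ Poly_Mapping.lookup \<gamma> j)" for \<gamma>
        proof -
          have "(\<Prod>j\<in>UNIV. (x' $ j) ^ Poly_Mapping.lookup \<gamma> j) =
            (\<Prod>j\<in>UNIV. (if j = i then 2 ^ Poly_Mapping.lookup \<gamma> j else 1) * (x $ j) ^ Poly_Mapping.lookup \<gamma> j)"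
            by (intro prod.cong) (auto simp: x'_def power_mult_distrib)
          then show ?thesis by (simp add: prod.distrib)
        qed
        then have "eval_mpoly q x = eval_mpoly p x' - 2 ^ Poly_Mapping.lookup \<alpha> i * eval_mpoly p x"
          unfolding q_def lin_ext_def
          by (simp add: eval_eq_lin_ext)
            (simp add: lin_ext_def f_def algebra_simps sum_subtractf sum_distrib_left)
        then show ?thesis by (simp add: less.prems)
      qed
      moreover have "card (Poly_Mapping.keys q) < card (Poly_Mapping.keys p)"
      proof (rule psubset_card_mono)
        have "\<alpha> \<in> Poly_Mapping.keys p" "\<alpha> \<notin> Poly_Mapping.keys q"
          using \<alpha> by (simp_all add: in_keys_iff q f_def)
        moreover have "Poly_Mapping.keys q \<subseteq> Poly_Mapping.keys p" by (auto simp: in_keys_iff q)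
        ultimately show "Poly_Mapping.keys q \<subset> Poly_Mapping.keys p" by blast
      qed simp
      ultimately have "q = 0" using less.hyps by blast
      then have "f \<beta> * Poly_Mapping.lookup p \<beta> = 0" using q[of \<beta>] by simp
      moreover have "f \<beta> \<noteq> 0" using i by (simp add: f_def)
      ultimately show ?thesis by simp
    qed
    then have "p = Poly_Mapping.single \<alpha> (Poly_Mapping.lookup p \<alpha>)"
      by (intro poly_mapping_eqI) (auto simp: lookup_single when_def)
    moreover have "eval_mpoly (Poly_Mapping.single \<alpha> c) ((\<chi> _. 1) :: real ^ 'n) = c" for c
      by (simp add: eval_eq_lin_ext)
    ultimately have "eval_mpoly p ((\<chi> _. 1) :: real ^ 'n) = Poly_Mapping.lookup p \<alpha>" by metis
    then show False using \<alpha> less.prems by simp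
  qed
qed

text \<open>The constraint polynomials are constants, and the constraints on \<open>y\<close> in degree 0 say that these
  constants are zero or nonnegative as required, because \<open>y 0 = 1\<close>.\<close>

lemma max_half_deg_0_unconstrained:
  fixes h :: "nat \<Rightarrow> ('n::finite, real) mpoly"
  assumes d: "max_half_deg h (m + k) = 0" and y: "y \<in> K_set h m k t"
  shows "real_variety (gen_ideal (h ` {1..m})) \<inter> basic_closed_set h m k = UNIV"
proof -
  have L: "eval_mpoly (h j) x = lin_ext y (h j * (1 * 1))" if "j \<in> {1..m + k}" for j and x :: "real ^ 'n"
  proof -
    have "half_deg (h j) \<le> 0" using half_deg_le_max[OF that, of h] d by simp
    then have keys: "h j \<in> polys_le 0" by (intro in_polys_le_half_deg) simp
    have "Poly_Mapping.keys (h j) \<subseteq> {0}"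
    proof
      fix \<alpha> assume "\<alpha> \<in> Poly_Mapping.keys (h j)"
      then have "mdeg \<alpha> = 0" using keys by (auto simp: polys_le_def monoms_def)
      then show "\<alpha> \<in> {0}" by (auto intro!: poly_mapping_eqI simp: mdeg_def)
    qed
    then have "lin_ext f (h j) = Poly_Mapping.lookup (h j) 0 *\<^sub>R f 0" for f :: "'n monom \<Rightarrow> real"
      using lin_ext_superset[of "{0}" "h j" f] by simp
    then show ?thesis using y by (simp add: eval_eq_lin_ext K_set_iff)
  qed
  have "eval_mpoly (h j) x = 0" if "j \<in> {1..m}" for j and x :: "real ^ 'n"
  proof -
    have "lin_ext y (h j * (1 * 1)) = 0"
      using y that one_in_polys_le unfolding K_set_iff by blast
    then show ?thesis using L[of j x] that by simp
  qed
  moreover have "0 \<le> eval_mpoly (h j) x" if "j \<in> {m+1..m+k}" for j and x :: "real ^ 'n"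
  proof -
    have "0 \<le> lin_ext y (h j * (1 * 1))"
      using y that one_in_polys_le unfolding K_set_iff by blast
    then show ?thesis using L[of j x] that by simp
  qed
  ultimately show ?thesis
    by (auto simp: real_variety_gen_ideal_iff basic_closed_set_def)
qed

theorem proposition4p5:
  fixes h :: "nat \<Rightarrow> ('n::finite, real) mpoly"
    and m k t :: nat
    and y :: "'n monom \<Rightarrow> real"
  defines "I \<equiv> gen_ideal (h ` {1..m})"
    and "S \<equiv> basic_closed_set h m k"
    and "d \<equiv> max_half_deg h (m + k)"
  assumes t: "d \<le> t"
    and y: "y \<in> K_set h m k t"
    and max: "\<And>z. z \<in> K_set h m k t \<Longrightarrow> moment_rank t z \<le> moment_rank t y"
  shows "(\<forall>s. 1 \<le> s \<and> s \<le> t \<and> moment_rank s y = moment_rank (s - 1) y \<longrightarrow>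
           (let J = gen_ideal (moment_kernel s y);
                W = complex_variety J;
                V = real_variety I \<inter> S
            in J \<subseteq> vanishing_ideal V \<and>
               complex_point ` V \<subseteq> W \<and>
               finite W \<and> card W = moment_rank s y \<and>
               (W = complex_point ` V \<longrightarrow> J = vanishing_ideal V)))
       \<and> (\<forall>s. d \<le> s \<and> s \<le> t \<and> moment_rank s y = moment_rank (s - d) y \<longrightarrow>
           vanishing_ideal (real_variety I \<inter> S) = gen_ideal (moment_kernel s y))"
proof -
  let ?V = "real_variety I \<inter> S" and ?J = "\<lambda>s. gen_ideal (moment_kernel s y)"
  have hd: "half_deg (h j) \<le> d" if "j \<in> {1..m + k}" for j
    using half_deg_le_max[OF that] by (simp add: d_def)
  have V_iff: "x \<in> ?V \<longleftrightarrow> (\<forall>j\<in>{1..m}. eval_mpoly (h j) x = 0) \<and> (\<forall>j\<in>{m+1..m+k}. 0 \<le> eval_mpoly (h j) x)" for x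
    by (auto simp: I_def S_def real_variety_gen_ideal_iff basic_closed_set_def)
  have psd: "0 \<le> lin_ext y (q * q)" if "q \<in> polys_le s" "s \<le> t" for q s
    using y that polys_le_mono[of s t] unfolding K_set_iff by blast
  have eq_0: "lin_ext y (h j * (p * q)) = 0"
    if "j \<in> {1..m}" "p \<in> polys_le (t - half_deg (h j))" "q \<in> polys_le (t - half_deg (h j))" for j p q
    using y that unfolding K_set_iff by blast
  have ge_0: "0 \<le> lin_ext y (h j * (q * q))"
    if "j \<in> {m+1..m+k}" "q \<in> polys_le (t - half_deg (h j))" for j q
    using y that unfolding K_set_iff by blast
  have JV: "?J s \<subseteq> vanishing_ideal ?V" if s: "s \<le> t" for s
  proof (rule gen_ideal_subset_vanishing_ideal)
    have "moment_kernel s y \<subseteq> moment_kernel t y"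
      using moment_kernel_Int_polys_le[OF psd[OF _ order_refl] s] by auto
    also have "\<dots> \<subseteq> vanishing_ideal ?V"
    proof
      fix p assume p: "p \<in> moment_kernel t y"
      have "eval_mpoly p x = 0" if "x \<in> ?V" for x
        using that hd t unfolding V_iff
        by (intro max_rank_kernel_vanishes[OF _ y max _ _ p]) (auto intro: order_trans)
      then show "p \<in> vanishing_ideal ?V" by (simp add: vanishing_ideal_def)
    qed
    finally show "moment_kernel s y \<subseteq> vanishing_ideal ?V" .
  qed
  have flat: "\<exists>q\<in>polys_le r. p - q \<in> moment_kernel s y"
    if "r \<le> s" "s \<le> t" "moment_rank s y = moment_rank r y" "p \<in> polys_le s" for r s p
    using that moment_kernel_Int_polys_le[OF psd[OF _ that(2)] that(1)]
    by (intro moment_rank_comparison(1)[of r s y y]) auto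
  show ?thesis
  proof (intro conjI allI impI)
    fix s assume "1 \<le> s \<and> s \<le> t \<and> moment_rank s y = moment_rank (s - 1) y"
    then have s: "1 \<le> s" "s \<le> t" "moment_rank s y = moment_rank (s - 1) y" by auto
    have flat': "\<exists>q\<in>polys_le (s - 1). p - q \<in> moment_kernel s y" if "p \<in> polys_le s" for p
      by (rule flat[OF _ s(2,3) that]) simp
    show "let J = ?J s; W = complex_variety J; V = ?V
            in J \<subseteq> vanishing_ideal V \<and> complex_point ` V \<subseteq> W \<and>
               finite W \<and> card W = moment_rank s y \<and>
               (W = complex_point ` V \<longrightarrow> J = vanishing_ideal V)"
    proof (rule flat_moment_kernel[OF psd[OF _ s(2)] s(1) flat'])
      fix W assume W: "finite W" "card W = moment_rank s y" "?J s = vanishing_ideal W"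
        "complex_variety (?J s) = complex_point ` W"
      have "complex_point ` ?V \<subseteq> complex_variety (?J s)"
        using JV[OF s(2)] by (auto simp: complex_variety_def vanishing_ideal_def eval_complex_point)
      moreover have inj: "inj complex_point" by (simp add: inj_def)
      then have "card (complex_variety (?J s)) = moment_rank s y"
        unfolding W(4) W(2)[symmetric] by (intro card_image) (auto intro: inj_on_subset)
      moreover have "?J s = vanishing_ideal ?V" if "complex_variety (?J s) = complex_point ` ?V"
      proof -
        have "complex_point ` W = complex_point ` ?V" using that W(4) by simp
        then have "W = ?V" unfolding inj_image_eq_iff[OF inj] .
        then show ?thesis using W(3) by simp
      qed
      moreover have "finite (complex_variety (?J s))" using W(1,4) by simp
      ultimately show ?thesis
        unfolding Let_def using JV[OF s(2)] by blast
    qed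
  next
    fix s assume "d \<le> s \<and> s \<le> t \<and> moment_rank s y = moment_rank (s - d) y"
    then have s: "d \<le> s" "s \<le> t" "moment_rank s y = moment_rank (s - d) y" by auto
    have "vanishing_ideal ?V \<subseteq> ?J s"
    proof (cases "d = 0")
      case True
      then have "?V = UNIV"
        using max_half_deg_0_unconstrained[OF _ y] by (simp add: I_def S_def d_def)
      then have "p = 0" if "p \<in> vanishing_ideal ?V" for p
        using that by (intro vanishes_everywhere_imp_0) (simp add: vanishing_ideal_def)
      then show ?thesis using subspace_0[OF subspace_gen_ideal] by blast
    next
      case False
      have flat': "\<exists>q\<in>polys_le (s - d). p - q \<in> moment_kernel s y" if "p \<in> polys_le s" for p
        by (rule flat[OF _ s(2,3) that]) simp
      have flat1: "\<exists>q\<in>polys_le (s - 1). p - q \<in> moment_kernel s y" if "p \<in> polys_le s" for p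
        using flat'[OF that] subsetD[OF polys_le_mono[of "s - d" "s - 1"]] False by fastforce
      have s1: "1 \<le> s" using False s(1) by simp
      show ?thesis
      proof (rule flat_moment_kernel[OF psd[OF _ s(2)] s1 flat1])
        fix \<Lambda> W
        assume W: "finite W" "?J s = vanishing_ideal W"
          and \<Lambda>: "linear \<Lambda>" "\<And>p. p \<in> polys_le (2 * s) \<Longrightarrow> \<Lambda> p = lin_ext y p"
            "\<And>p. p \<in> ?J s \<Longrightarrow> \<Lambda> p = 0" "\<And>p. 0 \<le> \<Lambda> (p * p)" "\<And>p. \<Lambda> (p * p) = 0 \<Longrightarrow> p \<in> ?J s"
          and red: "\<And>p. \<exists>q\<in>polys_le (s - 1). p - q \<in> ?J s"
        have "W \<subseteq> ?V"
        proof
          fix w assume w: "w \<in> W"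
          obtain e0 :: "real ^ 'n \<Rightarrow> ('n, real) mpoly" where e0:
            "\<And>w w'. w \<in> W \<Longrightarrow> w' \<in> W \<Longrightarrow> eval_mpoly (e0 w) w' = (if w' = w then 1 else 0)"
            using interpolation[OF W(1)] by blast
          obtain e1 where e1: "e1 \<in> polys_le (s - 1)" "e0 w - e1 \<in> ?J s" using red by blast
          have "e1 \<in> polys_le s" using e1(1) polys_le_mono[of "s - 1" s] by auto
          then obtain e where e: "e \<in> polys_le (s - d)" "e1 - e \<in> moment_kernel s y"
            using flat' by blast
          have "e1 - e \<in> ?J s" using e(2) gen_ideal_superset by blast
          then have "e0 w - e1 + (e1 - e) \<in> ?J s" by (intro gen_ideal_add e1)
          then have "eval_mpoly (e0 w - e) w' = 0" if "w' \<in> W" for w'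
            using that unfolding W(2) vanishing_ideal_def by simp
          then have ev: "eval_mpoly e w' = (if w' = w then 1 else 0)" if "w' \<in> W" for w'
            using e0[OF w that] that by force
          have "eval_mpoly e w \<noteq> 0" using ev[OF w] by simp
          then have "e \<notin> ?J s" using w unfolding W(2) vanishing_ideal_def by blast
          then have "\<Lambda> (e * e) \<noteq> 0" using \<Lambda>(5) by blast
          then have pos: "0 < \<Lambda> (e * e)" using \<Lambda>(4)[of e] by linarith
          have val: "lin_ext y (h j * (e * e)) = eval_mpoly (h j) w * \<Lambda> (e * e)" if j: "j \<in> {1..m + k}" for j
          proof -
            have "h j * (e * e) \<in> polys_le (2 * d + ((s - d) + (s - d)))"
              using hd[OF j] by (intro polys_le_mult e in_polys_le_half_deg) simp
            then have "lin_ext y (h j * (e * e)) = \<Lambda> (h j * (e * e))"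
              using s(1) by (intro \<Lambda>(2)[symmetric]) (simp add: mult_2)
            moreover have "h j * (e * e) - eval_mpoly (h j) w *\<^sub>R (e * e) \<in> ?J s"
              unfolding W(2) vanishing_ideal_def using ev by auto
            then have "\<Lambda> (h j * (e * e) - eval_mpoly (h j) w *\<^sub>R (e * e)) = 0"
              by (rule \<Lambda>(3))
            then have "\<Lambda> (h j * (e * e)) = eval_mpoly (h j) w * \<Lambda> (e * e)"
              by (simp add: linear_diff[OF \<Lambda>(1)] linear_scale[OF \<Lambda>(1)])
            ultimately show ?thesis by simp
          qed
          have e_le: "e \<in> polys_le (t - half_deg (h j))" if j: "j \<in> {1..m + k}" for j
          proof -
            have "s - d \<le> t - half_deg (h j)" using hd[OF j] s(2) by linarith
            then show ?thesis by (rule subsetD[OF polys_le_mono e(1)])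
          qed
          have "eval_mpoly (h j) w = 0" if j: "j \<in> {1..m}" for j
          proof -
            have "lin_ext y (h j * (e * e)) = 0"
              using j by (intro eq_0 e_le) auto
            then show ?thesis using val[of j] j pos by simp
          qed
          moreover have "0 \<le> eval_mpoly (h j) w" if j: "j \<in> {m+1..m+k}" for j
          proof -
            have "0 \<le> lin_ext y (h j * (e * e))"
              using j by (intro ge_0 e_le) auto
            then show ?thesis using val[of j] j pos by (simp add: zero_le_mult_iff)
          qed
          ultimately show "w \<in> ?V" unfolding V_iff by blast
        qed
        then show ?thesis unfolding W(2) by (auto simp: vanishing_ideal_def)
      qed
    qed
    then show "vanishing_ideal ?V = ?J s" using JV[OF s(2)] by blast
  qed
qed

end
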